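(* There exists an absolute constant $c>0$ such that the following holds. Let $m,n,N$ be positive integers with $n<N$, let $\boldsymbol{h}\in\mathbb{R}^m$ be a non-zero vector, and let $\Psi_1,\dots,\Psi_N\in\mathbb{R}^{n\times m}$ be random matrices such that either (a) all entries of all the matrices $\Psi_j$, $j=1,\dots,N$, are independent standard normal random variables (Gaussian ensemble); or (b) all entries of all the matrices $\Psi_j$, $j=1,\dots,N$, are independent Bernoulli random variables taking the values $+1$ and $-1$ with probability $1/2$ each (Bernoulli ensemble). Let $\varepsilon>0$ and let $k$ be a positive integer with $$k \le c\,\frac{n}{\log\big(\frac{N}{n\varepsilon}\big)}.$$ Then, with probability at least $1-\varepsilon$, all matrices $\Gamma$ having a $k$-sparse representation in the dictionary $\Psi=\{\Psi_j\}_{j=1}^N$ can be recovered from $\Gamma\boldsymbol{h}$ by Basis Pursuit.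
   Context: A matrix $\Gamma$ has a $k$-sparse representation in a matrix dictionary $\Psi=\{\Psi_j\}_{j=1}^N$ if $\Gamma=\sum_{j=1}^N x_j\Psi_j$ for some coefficient vector $\boldsymbol{x}$ with $\|\boldsymbol{x}\|_0=k$, where $\|\boldsymbol{x}\|_0$ is the number of non-zero entries of $\boldsymbol{x}$. For a vector $\boldsymbol{h}$, $(\Psi\boldsymbol{h})=(\Psi_1\boldsymbol{h}\,|\,\cdots\,|\,\Psi_N\boldsymbol{h})$ is the matrix with columns $\Psi_j\boldsymbol{h}$, so $\Gamma\boldsymbol{h}=(\Psi\boldsymbol{h})\boldsymbol{x}$. Basis Pursuit is the convex program $$\min\|\boldsymbol{x}'\|_1\quad\text{subject to}\quad(\Psi\boldsymbol{h})\boldsymbol{x}'=\Gamma\boldsymbol{h},\qquad \|\boldsymbol{x}'\|_1=\sum_j|x'_j|.$$ Basis Pursuit recovers $\Gamma$ from $\Gamma\boldsymbol{h}$ if the $k$-sparse coefficient vector $\boldsymbol{x}$ of $\Gamma$ is the unique solution of this program. The event in the claim is that this holds simultaneously for all $k$-sparse $\boldsymbol{x}$ (uniform recovery). $\log$ is the natural logarithm.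
   Formalization: Adds the assumption k ≤ c n (same c), without which the claim fails (e.g. N=n+1, ε=1−1/n, k=N, n large); it is implied when N/(nε) ≥ e. The constant c is stated per type of sample space, harmless since only the joint law of the entries matters. *)

theory Defs
  imports "HOL-Probability.Probability" "Jordan_Normal_Form.Matrix"
begin

section \<open>Sparse representations in a matrix dictionary\<close>

text \<open>Vectors and matrices are those of \<^theory>\<open>Jordan_Normal_Form.Matrix\<close>, whose dimensions are
  natural numbers, so that one constant can serve all dimensions.
  A dictionary is a family \<open>\<Psi> 0, \<dots>, \<Psi> (N - 1)\<close>; values at other indices are irrelevant.\<close>

definition l0_norm :: "real Matrix.vec \<Rightarrow> nat" where
  "l0_norm x = card {j. j < dim_vec x \<and> vec_index x j \<noteq> 0}"

definition l1_norm :: "real Matrix.vec \<Rightarrow> real" where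
  "l1_norm x = (\<Sum>j<dim_vec x. \<bar>vec_index x j\<bar>)"

definition dict_comb ::
  "nat \<Rightarrow> nat \<Rightarrow> nat \<Rightarrow> (nat \<Rightarrow> real Matrix.mat) \<Rightarrow> real Matrix.vec \<Rightarrow> real Matrix.mat" where
  "dict_comb n m N \<Psi> x = Matrix.mat n m (\<lambda>(i, l). \<Sum>j<N. vec_index x j * \<Psi> j $$ (i, l))"

definition sparse_representation ::
  "nat \<Rightarrow> nat \<Rightarrow> nat \<Rightarrow> (nat \<Rightarrow> real Matrix.mat) \<Rightarrow> nat \<Rightarrow> real Matrix.mat \<Rightarrow> real Matrix.vec \<Rightarrow> bool" where
  "sparse_representation n m N \<Psi> k \<Gamma> x \<longleftrightarrow>
     x \<in> carrier_vec N \<and> l0_norm x = k \<and> \<Gamma> = dict_comb n m N \<Psi> x"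

definition dict_apply ::
  "nat \<Rightarrow> nat \<Rightarrow> (nat \<Rightarrow> real Matrix.mat) \<Rightarrow> real Matrix.vec \<Rightarrow> real Matrix.mat" where
  "dict_apply n N \<Psi> h = mat_of_cols n (map (\<lambda>j. \<Psi> j *\<^sub>v h) [0..<N])"


section \<open>Basis Pursuit\<close>

definition bp_feasible :: "real Matrix.mat \<Rightarrow> real Matrix.vec \<Rightarrow> real Matrix.vec set" where
  "bp_feasible A y = {x. x \<in> carrier_vec (dim_col A) \<and> A *\<^sub>v x = y}"

definition bp_solutions :: "real Matrix.mat \<Rightarrow> real Matrix.vec \<Rightarrow> real Matrix.vec set" where
  "bp_solutions A y =
     {x \<in> bp_feasible A y. \<forall>x' \<in> bp_feasible A y. l1_norm x \<le> l1_norm x'}"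

text \<open>Every \<open>k\<close>-sparse coefficient vector \<open>x\<close> of every \<open>\<Gamma>\<close> must be the unique solution; in particular
  this fails if some \<open>\<Gamma>\<close> has two different \<open>k\<close>-sparse representations.\<close>

definition bp_recovers_all_sparse ::
  "nat \<Rightarrow> nat \<Rightarrow> nat \<Rightarrow> (nat \<Rightarrow> real Matrix.mat) \<Rightarrow> real Matrix.vec \<Rightarrow> nat \<Rightarrow> bool" where
  "bp_recovers_all_sparse n m N \<Psi> h k \<longleftrightarrow>
     (\<forall>\<Gamma> x. sparse_representation n m N \<Psi> k \<Gamma> x \<longrightarrow>
        bp_solutions (dict_apply n N \<Psi> h) (\<Gamma> *\<^sub>v h) = {x})"


section \<open>Random dictionaries\<close>

definition dict_entry ::
  "(nat \<Rightarrow> 'w \<Rightarrow> real Matrix.mat) \<Rightarrow> nat \<times> nat \<times> nat \<Rightarrow> 'w \<Rightarrow> real" where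
  "dict_entry \<Psi> = (\<lambda>(j, i, l) \<omega>. \<Psi> j \<omega> $$ (i, l))"

definition independent_entries ::
  "'w measure \<Rightarrow> nat \<Rightarrow> nat \<Rightarrow> nat \<Rightarrow> (nat \<Rightarrow> 'w \<Rightarrow> real Matrix.mat) \<Rightarrow> bool" where
  "independent_entries M n m N \<Psi> \<longleftrightarrow>
     (\<forall>j<N. \<forall>\<omega> \<in> space M. \<Psi> j \<omega> \<in> carrier_mat n m) \<and>
     prob_space.indep_vars M (\<lambda>_. borel) (dict_entry \<Psi>) ({..<N} \<times> {..<n} \<times> {..<m})"

definition gaussian_ensemble ::
  "'w measure \<Rightarrow> nat \<Rightarrow> nat \<Rightarrow> nat \<Rightarrow> (nat \<Rightarrow> 'w \<Rightarrow> real Matrix.mat) \<Rightarrow> bool" where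
  "gaussian_ensemble M n m N \<Psi> \<longleftrightarrow> independent_entries M n m N \<Psi> \<and>
     (\<forall>e \<in> {..<N} \<times> {..<n} \<times> {..<m}.
        distributed M lborel (dict_entry \<Psi> e) std_normal_density)"

definition bernoulli_ensemble ::
  "'w measure \<Rightarrow> nat \<Rightarrow> nat \<Rightarrow> nat \<Rightarrow> (nat \<Rightarrow> 'w \<Rightarrow> real Matrix.mat) \<Rightarrow> bool" where
  "bernoulli_ensemble M n m N \<Psi> \<longleftrightarrow> independent_entries M n m N \<Psi> \<and>
     (\<forall>e \<in> {..<N} \<times> {..<n} \<times> {..<m}.
        measure M {\<omega> \<in> space M. dict_entry \<Psi> e \<omega> = 1} = 1 / 2 \<and>
        measure M {\<omega> \<in> space M. dict_entry \<Psi> e \<omega> = - 1} = 1 / 2)"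

text \<open>Why the recovery theorem also assumes \<open>k \<le> c * n\<close>: the bound \<open>k \<le> c * n / ln (N / (n * \<epsilon>))\<close>
  alone is void when \<open>N / (n * \<epsilon>)\<close> is close to 1, and the claim is then false for every \<open>c > 0\<close>.
  Take \<open>N = n + 1\<close>, \<open>\<epsilon> = 1 - 1 / n\<close>, \<open>k = N\<close>. The bound holds for large \<open>n\<close>, as the logarithm is of
  order \<open>2 / n\<close>. But the \<open>n \<times> N\<close> matrix always has a kernel vector \<open>z \<noteq> 0\<close>, and if \<open>x\<close> has no zero
  entry then \<open>l1_norm\<close> is affine along \<open>x + t z\<close> near \<open>t = 0\<close>, so \<open>x\<close> is not the unique minimiser:
  recovery has probability 0, less than \<open>1 - \<epsilon> = 1 / n\<close>. Whenever \<open>N / (n * \<epsilon>) \<ge> exp 1\<close> the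
  additional assumption is implied by the other one.\<close>

end

theory Submission
  imports Defs
begin

text \<open>
  Dividing by \<open>\<parallel>h\<parallel>\<close>, the measurement matrix \<open>A\<close> has independent rows, and every normalised linear
  form in a row is centred, of variance 1 and subgaussian, in both ensembles.
  If recovery of some \<open>k\<close>-sparse vector fails, the null space property yields a kernel vector
  \<open>z \<noteq> 0\<close> of \<open>A\<close> with \<open>\<parallel>z\<parallel>\<^sub>1 \<le> 2 sqrt k \<parallel>z\<parallel>\<^sub>2\<close>. Scaling \<open>z\<close> to length \<open>512 sqrt k\<close> and rounding
  its entries to integers one after the other, each time in the direction that leaves
  \<open>\<parallel>A w\<parallel>\<^sub>2\<^sup>2 + 16 n \<parallel>w\<parallel>\<^sub>1\<close> smaller, produces an integer vector \<open>w\<close> with \<open>\<parallel>w\<parallel>\<^sub>1 \<le> 2048 k\<close> and \<open>\<parallel>A w\<parallel>\<^sub>2\<^sup>2 < n \<parallel>w\<parallel>\<^sub>2\<^sup>2 / 4\<close>, as soon as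
  all columns of \<open>A\<close> have squared length at most \<open>16 n\<close>. For a fixed \<open>w\<close> this inequality has
  probability at most \<open>exp (- n / 96)\<close>, a column is too long with probability at most
  \<open>exp (- 3 n)\<close>, and there are so few lattice points \<open>w\<close> that the union bound suffices.
\<close>

section \<open>Rounding to lattice points\<close>

text \<open>Rounding \<open>s\<close> to its floor with probability \<open>1 - p\<close> and to the
  next integer with probability \<open>p\<close> is unbiased. The averaged objective exceeds its
  value at \<open>s\<close> by the variance \<open>p * (1 - p)\<close> times the squared column
  length, hence by at most \<open>B * \<bar>s\<bar>\<close>, and one of the two outcomes is no worse
  than the average.\<close>

lemma coordinate_rounding:
  fixes u a :: "nat \<Rightarrow> real" and s B :: real
  assumes B: "(\<Sum>i<n. (a i)\<^sup>2) \<le> B"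
  shows "\<exists>v::int. \<bar>of_int v - s\<bar> \<le> 1 \<and>
    (\<Sum>i<n. (u i + a i * of_int v)\<^sup>2) + B * \<bar>of_int v\<bar> \<le>
    (\<Sum>i<n. (u i + a i * s)\<^sup>2) + B * \<bar>s\<bar> + B * \<bar>s\<bar>"
proof -
  define f where "f = \<lfloor>s\<rfloor>"
  define p where "p = s - of_int f"
  define g where "g v = (\<Sum>i<n. (u i + a i * v)\<^sup>2) + B * \<bar>v\<bar>" for v
  have p: "0 \<le> p" "p \<le> 1" and s: "s = of_int f + p"
    unfolding p_def f_def by linarith+
  have B0: "0 \<le> B" using B sum_nonneg[of "{..<n}" "\<lambda>i. (a i)\<^sup>2"] by simp
  \<comment> \<open>The absolute value is affine between consecutive integers, so averaging
    preserves it. The variance is at most \<open>\<bar>s\<bar>\<close> because \<open>s >= p\<close>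
    if \<open>f >= 0\<close>, and \<open>\<bar>s\<bar> >= 1 - p\<close> otherwise.\<close>
  have abs: "(1 - p) * \<bar>of_int f\<bar> + p * \<bar>of_int f + 1\<bar> = \<bar>s\<bar> \<and> p * (1 - p) \<le> \<bar>s\<bar>"
  proof (cases "f \<ge> 0")
    case True
    have "p * (1 - p) \<le> p" using p mult_left_mono[of "1 - p" 1 p] by simp
    then show ?thesis using True p s by (simp add: algebra_simps)
  next
    case False
    then have "of_int f \<le> (-1::real)" by simp
    moreover have "p * (1 - p) \<le> 1 - p" using p mult_right_mono[of p 1 "1 - p"] by simp
    ultimately show ?thesis using p s by (simp add: algebra_simps)
  qed
  have "(1 - p) * (u i + a i * of_int f)\<^sup>2 + p * (u i + a i * (of_int f + 1))\<^sup>2 =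
      (u i + a i * s)\<^sup>2 + p * (1 - p) * (a i)\<^sup>2" for i
    unfolding s by (simp add: power2_eq_square algebra_simps)
  then have "(1 - p) * (\<Sum>i<n. (u i + a i * of_int f)\<^sup>2) + p * (\<Sum>i<n. (u i + a i * (of_int f + 1))\<^sup>2) =
      (\<Sum>i<n. (u i + a i * s)\<^sup>2) + p * (1 - p) * (\<Sum>i<n. (a i)\<^sup>2)"
    by (simp add: sum_distrib_left sum.distrib[symmetric])
  moreover have "p * (1 - p) * (\<Sum>i<n. (a i)\<^sup>2) \<le> \<bar>s\<bar> * B"
    using abs B B0 p by (intro mult_mono) (auto intro: sum_nonneg)
  moreover have "B * ((1 - p) * \<bar>of_int f\<bar> + p * \<bar>of_int f + 1\<bar>) = B * \<bar>s\<bar>"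
    using abs by simp
  ultimately have avg: "(1 - p) * g (of_int f) + p * g (of_int f + 1) \<le> g s + B * \<bar>s\<bar>"
    unfolding g_def by (simp add: algebra_simps)
  have "g (of_int f) \<le> g s + B * \<bar>s\<bar> \<or> g (of_int f + 1) \<le> g s + B * \<bar>s\<bar>"
  proof (rule ccontr)
    define G where "G = g s + B * \<bar>s\<bar>"
    assume "\<not> ?thesis"
    then have 1: "g (of_int f) > G" "g (of_int f + 1) > G" by (auto simp: G_def)
    have "(1 - p) * (g (of_int f) - G) + p * (g (of_int f + 1) - G) > 0"
    proof (cases "p = 0")
      case False
      with p 1 have "p * (g (of_int f + 1) - G) > 0" by simp
      moreover have "(1 - p) * (g (of_int f) - G) \<ge> 0" using p 1 by simp
      ultimately show ?thesis by linarith
    qed (use 1 in simp)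
    with avg show False unfolding G_def by (simp add: algebra_simps)
  qed
  moreover have "\<bar>of_int f - s\<bar> \<le> 1" "\<bar>of_int (f + 1) - s\<bar> \<le> 1" using p s by auto
  ultimately show ?thesis
    using exI[of "\<lambda>v. \<bar>of_int v - s\<bar> \<le> 1 \<and> g (of_int v) \<le> g s + B * \<bar>s\<bar>" f]
      exI[of "\<lambda>v. \<bar>of_int v - s\<bar> \<le> 1 \<and> g (of_int v) \<le> g s + B * \<bar>s\<bar>" "f + 1"]
    unfolding g_def[symmetric] by auto
qed

lemma sum_fun_upd_split:
  fixes w :: "nat \<Rightarrow> real"
  assumes "x < (N::nat)"
  shows "(\<Sum>j<N. \<phi> j ((w(x := v)) j)) = (\<Sum>j\<in>{..<N} - {x}. \<phi> j (w j)) + (\<phi> x v :: real)"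
  using assms by (subst sum.remove[of _ x]) (auto intro!: sum.cong)

text \<open>A derandomised form of Maurey's empirical method: rounding every coordinate at random without
  bias increases the expectation of the squared norm of the image only by the sum of the variances.\<close>

lemma integer_rounding:
  fixes A :: "nat \<Rightarrow> nat \<Rightarrow> real" and y :: "nat \<Rightarrow> real"
  assumes B: "\<And>j. j < N \<Longrightarrow> (\<Sum>i<n. (A i j)\<^sup>2) \<le> B"
  shows "\<exists>w::nat \<Rightarrow> int. (\<forall>j<N. \<bar>of_int (w j) - y j\<bar> \<le> 1) \<and>
    (\<Sum>i<n. (\<Sum>j<N. A i j * of_int (w j))\<^sup>2) + B * (\<Sum>j<N. \<bar>of_int (w j)\<bar>) \<le>
    (\<Sum>i<n. (\<Sum>j<N. A i j * y j)\<^sup>2) + 2 * B * (\<Sum>j<N. \<bar>y j\<bar>)"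
proof -
  define F where "F w = (\<Sum>i<n. (\<Sum>j<N. A i j * w j)\<^sup>2) + B * (\<Sum>j<N. \<bar>w j\<bar>)" for w :: "nat \<Rightarrow> real"
  \<comment> \<open>\<open>J\<close> is the set of coordinates rounded so far. All others still
    carry the entries of \<open>y\<close>, so rounding coordinate \<open>x\<close> costs
    \<open>B * \<bar>y x\<bar>\<close>.\<close>
  have "J \<subseteq> {..<N} \<Longrightarrow> \<exists>w. (\<forall>j\<in>J. w j \<in> \<int> \<and> \<bar>w j - y j\<bar> \<le> 1) \<and> (\<forall>j. j \<notin> J \<longrightarrow> w j = y j) \<and>
     F w \<le> F y + B * (\<Sum>j\<in>J. \<bar>y j\<bar>)" if "finite J" for J
    using that
  proof (induction J rule: finite_induct)
    case (insert x J)
    then obtain w where w: "\<forall>j\<in>J. w j \<in> \<int> \<and> \<bar>w j - y j\<bar> \<le> 1" "\<forall>j. j \<notin> J \<longrightarrow> w j = y j"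
      "F w \<le> F y + B * (\<Sum>j\<in>J. \<bar>y j\<bar>)" by auto
    have x: "x < N" using insert by auto
    define u where "u i = (\<Sum>j\<in>{..<N}-{x}. A i j * w j)" for i
    obtain v :: int where v: "\<bar>of_int v - y x\<bar> \<le> 1" and
      le: "(\<Sum>i<n. (u i + A i x * of_int v)\<^sup>2) + B * \<bar>of_int v\<bar> \<le>
      (\<Sum>i<n. (u i + A i x * y x)\<^sup>2) + B * \<bar>y x\<bar> + B * \<bar>y x\<bar>"
      using coordinate_rounding[OF B[OF x]] by blast
    have F: "F (w(x := r)) = (\<Sum>i<n. (u i + A i x * r)\<^sup>2) + B * \<bar>r\<bar> + B * (\<Sum>j\<in>{..<N}-{x}. \<bar>w j\<bar>)" for r
      unfolding F_def u_def sum_fun_upd_split[OF x, of "\<lambda>j r. A _ j * r"]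
        sum_fun_upd_split[OF x, of "\<lambda>_ r. \<bar>r\<bar>"]
      by (simp add: algebra_simps)
    have wx: "w(x := y x) = w" using w(2) insert.hyps by auto
    have "F (w(x := of_int v)) \<le> F w + B * \<bar>y x\<bar>"
      using le F[of "of_int v"] F[of "y x"] unfolding wx by linarith
    also have "\<dots> \<le> F y + B * (\<Sum>j\<in>insert x J. \<bar>y j\<bar>)"
      using w(3) insert.hyps by (simp add: algebra_simps)
    finally have "F (w(x := of_int v)) \<le> F y + B * (\<Sum>j\<in>insert x J. \<bar>y j\<bar>)" .
    moreover have "\<forall>j\<in>insert x J. (w(x := of_int v)) j \<in> \<int> \<and> \<bar>(w(x := of_int v)) j - y j\<bar> \<le> 1"
      and "\<forall>j. j \<notin> insert x J \<longrightarrow> (w(x := of_int v)) j = y j"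
      using w(1,2) v by auto
    ultimately show ?case by blast
  qed (auto intro: exI[of _ y])
  from this[of "{..<N}"] obtain w where w: "\<forall>j<N. w j \<in> \<int> \<and> \<bar>w j - y j\<bar> \<le> 1"
    "F w \<le> F y + B * (\<Sum>j<N. \<bar>y j\<bar>)" by auto
  define w' where "w' j = \<lfloor>w j\<rfloor>" for j
  have w': "of_int (w' j) = w j" if "j < N" for j
    using w(1) that unfolding w'_def by simp
  show ?thesis
    using w by (intro exI[of _ w']) (simp add: w' F_def)
qed

section \<open>Counting the lattice points of an l1 ball\<close>

text \<open>\<open>PiE\<close> fixes the values at indices from \<open>N\<close> on, so that each
  lattice point is one function and the set is finite.\<close>

definition integer_l1_ball :: "nat \<Rightarrow> nat \<Rightarrow> (nat \<Rightarrow> int) set" where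
  "integer_l1_ball N r = {w \<in> PiE {..<N} (\<lambda>_. UNIV). (\<Sum>j<N. \<bar>w j\<bar>) \<le> int r}"

lemma integer_l1_ball_subset: "integer_l1_ball N r \<subseteq> PiE {..<N} (\<lambda>_. {- int r..int r})"
proof
  fix w assume w: "w \<in> integer_l1_ball N r"
  have "\<bar>w j\<bar> \<le> int r" if "j < N" for j
    using w member_le_sum[of j "{..<N}" "\<lambda>j. \<bar>w j\<bar>"] that by (auto simp: integer_l1_ball_def)
  then have "- int r \<le> w j \<and> w j \<le> int r" if "j < N" for j
    using that by (force simp: abs_le_iff)
  then show "w \<in> PiE {..<N} (\<lambda>_. {- int r..int r})"
    using w by (simp add: integer_l1_ball_def PiE_iff)
qed

lemma finite_integer_l1_ball: "finite (integer_l1_ball N r)"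
  by (rule finite_subset[OF integer_l1_ball_subset]) (auto intro: finite_PiE)

lemma sum_power_abs:
  fixes x :: real
  shows "(1 - x) * (\<Sum>a\<in>{- int r..int r}. x ^ nat \<bar>a\<bar>) = 1 + x - 2 * x ^ Suc r"
proof (induction r)
  case (Suc r)
  have "{- int (Suc r)..int (Suc r)} = insert (int (Suc r)) (insert (- int (Suc r)) {- int r..int r})"
    by auto
  then have "(\<Sum>a\<in>{- int (Suc r)..int (Suc r)}. x ^ nat \<bar>a\<bar>) =
      (\<Sum>a\<in>{- int r..int r}. x ^ nat \<bar>a\<bar>) + 2 * x ^ nat (1 + int r)"
    by (simp add: add.commute)
  moreover have "nat (1 + int r) = Suc r" by simp
  ultimately have "(1 - x) * (\<Sum>a\<in>{- int (Suc r)..int (Suc r)}. x ^ nat \<bar>a\<bar>) =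
      1 + x - 2 * x ^ Suc r + (1 - x) * (2 * x ^ Suc r)"
    unfolding Suc[symmetric] by (simp only: distrib_left)
  then show ?case by (simp add: algebra_simps)
qed simp

text \<open>Chernoff's method for counting: each point of the ball contributes at least \<open>x ^ r\<close> to the
  generating function of the \<open>l1\<close>-norm, and \<open>x = r / (2 N + r)\<close> is close to optimal.\<close>

lemma card_integer_l1_ball:
  assumes "r > 0"
  shows "real (card (integer_l1_ball N r)) \<le> exp r * ((2 * real N + r) / r) ^ r"
\<comment> \<open>For \<open>N = 0\<close> the parameter chosen below would equal 1, where the
  closed form of the generating function says nothing.\<close>
proof (cases "N = 0")
  case True
  have "card (integer_l1_ball N r) \<le> card (PiE {..<N} (\<lambda>_. {- int r..int r}))"
    by (intro card_mono integer_l1_ball_subset) (auto intro: finite_PiE)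
  with True assms show ?thesis by (simp add: order.trans[OF _ one_le_exp_iff[THEN iffD2]])
next
  case False
  define x where "x = r / (2 * real N + r)"
  have x: "0 < x" "x < 1" using assms False by (auto simp: x_def field_simps)
  define G where "G = (\<Sum>a\<in>{- int r..int r}. x ^ nat \<bar>a\<bar>)"
  have "(1 - x) * G \<le> 1 + x" unfolding G_def sum_power_abs using x by simp
  \<comment> \<open>The choice of \<open>x\<close> makes \<open>(1 + x) / (1 - x)\<close> equal to
    \<open>1 + r / N\<close>, whose \<open>N\<close>-th power stays below
    \<open>exp r\<close>.\<close>
  also have "1 + x = (1 - x) * (1 + r / N)"
  proof -
    have "x * (2 * real N + r) = r" using assms by (simp add: x_def)
    then show ?thesis using False by (simp add: field_simps)
  qed
  finally have G: "G \<le> 1 + r / N" using x by simp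
  have G0: "G \<ge> 0" unfolding G_def using x by (intro sum_nonneg) auto
  have "real (card (integer_l1_ball N r)) * x ^ r = (\<Sum>w\<in>integer_l1_ball N r. x ^ r)" by simp
  also have "\<dots> \<le> (\<Sum>w\<in>integer_l1_ball N r. \<Prod>j<N. x ^ nat \<bar>w j\<bar>)"
  proof (intro sum_mono)
    fix w assume w: "w \<in> integer_l1_ball N r"
    have "int (\<Sum>j<N. nat \<bar>w j\<bar>) = (\<Sum>j<N. \<bar>w j\<bar>)" by simp
    then have "(\<Sum>j<N. nat \<bar>w j\<bar>) \<le> r"
      using w by (simp only: integer_l1_ball_def mem_Collect_eq of_nat_le_iff[symmetric, where 'a = int])
    then have "x ^ r \<le> x ^ (\<Sum>j<N. nat \<bar>w j\<bar>)" using x by (intro power_decreasing) auto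
    then show "x ^ r \<le> (\<Prod>j<N. x ^ nat \<bar>w j\<bar>)" by (simp add: power_sum)
  qed
  \<comment> \<open>Enlarging the ball to the surrounding cube lets the sum factor into
    \<open>N\<close> equal one-dimensional sums.\<close>
  also have "\<dots> \<le> (\<Sum>w\<in>PiE {..<N} (\<lambda>_. {- int r..int r}). \<Prod>j<N. x ^ nat \<bar>w j\<bar>)"
  proof (rule sum_mono2[OF _ integer_l1_ball_subset])
    show "finite (PiE {..<N} (\<lambda>_. {- int r..int r}))" by (rule finite_PiE) auto
    show "0 \<le> (\<Prod>j<N. x ^ nat \<bar>w j\<bar>)" for w :: "nat \<Rightarrow> int"
      by (rule prod_nonneg) (use x in simp)
  qed
  also have "\<dots> = G ^ N"
    unfolding G_def by (subst prod_sum_PiE[symmetric]) simp_all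
  also have "\<dots> \<le> (1 + r / N) ^ N" using G G0 by (intro power_mono)
  also have "\<dots> \<le> exp (r / N) ^ N"
    by (intro power_mono) (auto simp: exp_ge_add_one_self)
  also have "\<dots> = exp r" using False by (subst exp_of_nat_mult[symmetric]) simp
  finally have "real (card (integer_l1_ball N r)) \<le> exp r / x ^ r"
    using x by (simp add: pos_le_divide_eq)
  also have "\<dots> = exp r * ((2 * real N + r) / r) ^ r"
    unfolding x_def by (simp add: power_divide)
  finally show ?thesis .
qed

text \<open>The constants balance as follows: \<open>y\<close> has squared length
  \<open>262144 k\<close> and l1-norm at most \<open>1024 k\<close>, so the rounded objective is at
  most \<open>32768 n k\<close>. This bounds the l1-norm of \<open>w\<close> by
  \<open>2048 k\<close>, while \<open>n / 4\<close> times the squared length of \<open>w\<close> is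
  still at least \<open>65024 n k\<close>.\<close>

lemma lattice_point_of_kernel_vector:
  fixes A :: "nat \<Rightarrow> nat \<Rightarrow> real" and z :: "nat \<Rightarrow> real"
  assumes col: "\<And>j. j < N \<Longrightarrow> (\<Sum>i<n. (A i j)\<^sup>2) \<le> 16 * real n"
    and ker: "\<And>i. i < n \<Longrightarrow> (\<Sum>j<N. A i j * z j) = 0"
    and nz: "\<exists>j<N. z j \<noteq> 0"
    and flat: "(\<Sum>j<N. \<bar>z j\<bar>) \<le> 2 * sqrt k * sqrt (\<Sum>j<N. (z j)\<^sup>2)"
    and k: "k > 0" and n: "n > 0"
  shows "\<exists>w \<in> integer_l1_ball N (2048 * k).
    (\<Sum>i<n. (\<Sum>j<N. A i j * of_int (w j))\<^sup>2) < n / 4 * (\<Sum>j<N. (of_int (w j))\<^sup>2)"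
proof -
  define b where "b = sqrt (\<Sum>j<N. (z j)\<^sup>2)"
  have b2: "b\<^sup>2 = (\<Sum>j<N. (z j)\<^sup>2)" unfolding b_def by (simp add: sum_nonneg)
  have b: "b > 0"
  proof -
    obtain j where "j < N" "z j \<noteq> 0" using nz by auto
    then have "(\<Sum>j<N. (z j)\<^sup>2) > 0" by (intro sum_pos2[of _ j]) auto
    then show ?thesis unfolding b_def by simp
  qed
  define t where "t = 512 * sqrt k"
  have t: "t > 0" and t2: "t\<^sup>2 = 262144 * k" using k unfolding t_def by (auto simp: power_mult_distrib)
  define y where "y j = t / b * z j" for j
  have y2: "(\<Sum>j<N. (y j)\<^sup>2) = 262144 * k"
    unfolding y_def power_mult_distrib sum_distrib_left[symmetric] b2[symmetric]
    using b by (simp add: t2 power_divide)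
  have y1: "(\<Sum>j<N. \<bar>y j\<bar>) \<le> 1024 * k"
  proof -
    have "(\<Sum>j<N. \<bar>y j\<bar>) = t / b * (\<Sum>j<N. \<bar>z j\<bar>)"
      using t b by (simp add: y_def abs_mult sum_distrib_left)
    also have "\<dots> \<le> t / b * (2 * sqrt k * b)"
      using flat t b by (intro mult_left_mono) (auto simp: b_def)
    also have "\<dots> = 1024 * (sqrt k * sqrt k)" using b by (simp add: t_def)
    finally show ?thesis by simp
  qed
  have "(\<Sum>j<N. A i j * y j) = t / b * (\<Sum>j<N. A i j * z j)" for i
    by (simp add: y_def sum_distrib_left mult_ac)
  then have Ay: "(\<Sum>i<n. (\<Sum>j<N. A i j * y j)\<^sup>2) = 0" using ker by simp
  obtain w :: "nat \<Rightarrow> int" where w: "\<And>j. j < N \<Longrightarrow> \<bar>of_int (w j) - y j\<bar> \<le> 1" and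
    le: "(\<Sum>i<n. (\<Sum>j<N. A i j * of_int (w j))\<^sup>2) + 16 * real n * (\<Sum>j<N. \<bar>real_of_int (w j)\<bar>) \<le>
      2 * (16 * real n) * (\<Sum>j<N. \<bar>y j\<bar>)"
    using integer_rounding[of N A n "16 * real n" y] col unfolding Ay by auto
  have le1: "2 * (16 * real n) * (\<Sum>j<N. \<bar>y j\<bar>) \<le> 2 * (16 * real n) * (1024 * real k)"
    using y1 by (intro mult_left_mono) auto
  have nn: "0 \<le> (\<Sum>i<n. (\<Sum>j<N. A i j * of_int (w j))\<^sup>2)" "0 \<le> (\<Sum>j<N. \<bar>real_of_int (w j)\<bar>)"
    by (auto intro: sum_nonneg)
  have "real n * (\<Sum>j<N. \<bar>real_of_int (w j)\<bar>) \<le> real n * (2048 * real k)" using le le1 nn by linarith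
  then have "(\<Sum>j<N. \<bar>real_of_int (w j)\<bar>) \<le> 2048 * k" using n by simp
  then have "real_of_int (\<Sum>j<N. \<bar>w j\<bar>) \<le> real_of_int (int (2048 * k))" by simp
  then have l1: "(\<Sum>j<N. \<bar>w j\<bar>) \<le> int (2048 * k)" by (simp only: of_int_le_iff)
  \<comment> \<open>Entries move by at most 1, so rounding lowers the squared length by at most
    twice the l1-norm of \<open>y\<close>, less than one percent of \<open>262144 k\<close>.\<close>
  have "(of_int (w j))\<^sup>2 \<ge> (y j)\<^sup>2 - 2 * \<bar>y j\<bar>" if "j < N" for j
  proof -
    define d where "d = of_int (w j) - y j"
    have "y j * d \<ge> - (\<bar>y j\<bar> * 1)"
      using w[OF that] mult_left_mono[of "\<bar>d\<bar>" 1 "\<bar>y j\<bar>"] unfolding d_def[symmetric]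
      by (simp add: abs_mult[symmetric])
    moreover have "of_int (w j) = y j + d" by (simp add: d_def)
    moreover have "d\<^sup>2 \<ge> 0" by simp
    ultimately show ?thesis by (simp only: power2_sum)
  qed
  then have "(\<Sum>j<N. (of_int (w j))\<^sup>2) \<ge> (\<Sum>j<N. (y j)\<^sup>2 - 2 * \<bar>y j\<bar>)" by (intro sum_mono) auto
  then have "(\<Sum>j<N. (real_of_int (w j))\<^sup>2) \<ge> 262144 * k - 2 * (1024 * k)"
    using y1 y2 by (simp add: sum_subtractf sum_distrib_left[symmetric])
  then have "n / 4 * (\<Sum>j<N. (real_of_int (w j))\<^sup>2) \<ge> n / 4 * (260096 * k)"
    by (intro mult_left_mono) auto
  moreover have "real n * k > 0" using n k by simp
  moreover have "real n * (\<Sum>j<N. \<bar>real_of_int (w j)\<bar>) \<ge> 0" using nn by simp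
  ultimately have lt: "(\<Sum>i<n. (\<Sum>j<N. A i j * of_int (w j))\<^sup>2) < n / 4 * (\<Sum>j<N. (real_of_int (w j))\<^sup>2)"
    using le le1 nn by linarith
  define w' where "w' = restrict w {..<N}"
  have "w' \<in> integer_l1_ball N (2048 * k)" using l1 by (auto simp: integer_l1_ball_def w'_def)
  moreover have "\<And>j. j < N \<Longrightarrow> w' j = w j" by (simp add: w'_def)
  ultimately show ?thesis using lt by (intro bexI[of _ w']) auto
qed


section \<open>The null space property\<close>

text \<open>\<open>S\<close> has exactly \<open>k\<close> elements to match the exact condition
  \<open>l0_norm x = k\<close>; for \<open>k > N\<close> this property and recovery both hold
  vacuously.\<close>

definition null_space_property :: "nat \<Rightarrow> nat \<Rightarrow> nat \<Rightarrow> (nat \<Rightarrow> nat \<Rightarrow> real) \<Rightarrow> bool" where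
  "null_space_property n N k A \<longleftrightarrow>
     (\<forall>S z. S \<subseteq> {..<N} \<longrightarrow> card S = k \<longrightarrow> (\<forall>i<n. (\<Sum>j<N. A i j * z j) = 0) \<longrightarrow> (\<exists>j<N. z j \<noteq> 0) \<longrightarrow>
        (\<Sum>j\<in>S. \<bar>z j\<bar>) < (\<Sum>j\<in>{..<N} - S. \<bar>z j\<bar>))"

text \<open>The entries of \<open>dict_apply n N \<Psi> h\<close> as a plain function, so that
  kernel conditions become finite sums.\<close>

definition measurement :: "nat \<Rightarrow> (nat \<Rightarrow> real Matrix.mat) \<Rightarrow> real Matrix.vec \<Rightarrow> nat \<Rightarrow> nat \<Rightarrow> real" where
  "measurement m \<Psi> h i j = (\<Sum>l<m. \<Psi> j $$ (i, l) * vec_index h l)"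

lemma dict_apply_mult:
  assumes \<Psi>: "\<forall>j<N. \<Psi> j \<in> carrier_mat n m" and h: "h \<in> carrier_vec m"
    and x: "x \<in> carrier_vec N" and i: "i < n"
  shows "vec_index (dict_apply n N \<Psi> h *\<^sub>v x) i = (\<Sum>j<N. measurement m \<Psi> h i j * vec_index x j)"
proof -
  have "(dict_apply n N \<Psi> h) $$ (i, j) = measurement m \<Psi> h i j" if "j < N" for j
    using \<Psi>[rule_format, OF that] h i that
    by (simp add: dict_apply_def mat_of_cols_index measurement_def scalar_prod_def lessThan_atLeast0 row_def)
  then show ?thesis using x i
    by (simp add: scalar_prod_def lessThan_atLeast0 dict_apply_def)
qed

lemma dict_comb_mult:
  assumes h: "h \<in> carrier_vec m" and i: "i < n"
  shows "vec_index (dict_comb n m N \<Psi> x *\<^sub>v h) i = (\<Sum>j<N. measurement m \<Psi> h i j * vec_index x j)"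
proof -
  have "vec_index (dict_comb n m N \<Psi> x *\<^sub>v h) i =
      (\<Sum>l<m. (\<Sum>j<N. vec_index x j * \<Psi> j $$ (i, l)) * vec_index h l)"
    using h i by (simp add: dict_comb_def scalar_prod_def lessThan_atLeast0)
  also have "\<dots> = (\<Sum>j<N. measurement m \<Psi> h i j * vec_index x j)"
    unfolding measurement_def sum_distrib_right by (subst sum.swap) (simp add: mult_ac)
  finally show ?thesis .
qed

lemma bp_feasible_dict:
  assumes \<Psi>: "\<forall>j<N. \<Psi> j \<in> carrier_mat n m" and h: "h \<in> carrier_vec m"
  shows "x' \<in> bp_feasible (dict_apply n N \<Psi> h) (dict_comb n m N \<Psi> x *\<^sub>v h) \<longleftrightarrow>
    x' \<in> carrier_vec N \<and>
    (\<forall>i<n. (\<Sum>j<N. measurement m \<Psi> h i j * (vec_index x' j - vec_index x j)) = 0)"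
proof -
  have dims: "dim_col (dict_apply n N \<Psi> h) = N" "dim_row (dict_apply n N \<Psi> h) = n"
    "dim_row (dict_comb n m N \<Psi> x) = n"
    by (simp_all add: dict_apply_def dict_comb_def)
  have "dict_apply n N \<Psi> h *\<^sub>v x' = dict_comb n m N \<Psi> x *\<^sub>v h \<longleftrightarrow>
      (\<forall>i<n. vec_index (dict_apply n N \<Psi> h *\<^sub>v x') i = vec_index (dict_comb n m N \<Psi> x *\<^sub>v h) i)"
    by (simp add: vec_eq_iff dims del: index_mult_mat_vec)
  also have "\<dots> \<longleftrightarrow> (\<forall>i<n. (\<Sum>j<N. measurement m \<Psi> h i j * (vec_index x' j - vec_index x j)) = 0)"
    if "x' \<in> carrier_vec N"
    by (simp add: dict_apply_mult[OF \<Psi> h that] dict_comb_mult[OF h] right_diff_distrib sum_subtractf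
        del: index_mult_mat_vec)
  finally show ?thesis by (auto simp only: bp_feasible_def dims mem_Collect_eq)
qed

lemma sum_split_subset:
  fixes f :: "nat \<Rightarrow> real"
  shows "S \<subseteq> {..<N} \<Longrightarrow> (\<Sum>j<N. f j) = (\<Sum>j\<in>S. f j) + (\<Sum>j\<in>{..<N} - S. f j)"
  by (subst add.commute, rule sum.subset_diff) auto

text \<open>For a feasible \<open>x'\<close> the difference \<open>z\<close> to \<open>x\<close> is
  a kernel vector. Passing from \<open>x\<close> to \<open>x'\<close> lowers the l1-norm on the
  support by at most the mass of \<open>z\<close> there, and adds the full mass of \<open>z\<close>
  off the support, where \<open>x\<close> vanishes.\<close>

lemma null_space_property_imp_recovers:
  assumes \<Psi>: "\<forall>j<N. \<Psi> j \<in> carrier_mat n m" and h: "h \<in> carrier_vec m"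
    and nsp: "null_space_property n N k (measurement m \<Psi> h)"
  shows "bp_recovers_all_sparse n m N \<Psi> h k"
  unfolding bp_recovers_all_sparse_def
proof (intro allI impI)
  fix \<Gamma> x assume "sparse_representation n m N \<Psi> k \<Gamma> x"
  then have x: "x \<in> carrier_vec N" "l0_norm x = k" and \<Gamma>: "\<Gamma> = dict_comb n m N \<Psi> x"
    by (auto simp: sparse_representation_def)
  define S where "S = {j. j < N \<and> vec_index x j \<noteq> 0}"
  have S: "S \<subseteq> {..<N}" "card S = k" using x by (auto simp: S_def l0_norm_def)
  let ?F = "bp_feasible (dict_apply n N \<Psi> h) (\<Gamma> *\<^sub>v h)"
  have xF: "x \<in> ?F" unfolding \<Gamma> bp_feasible_dict[OF \<Psi> h] using x by simp
  have less: "l1_norm x < l1_norm x'" if x': "x' \<in> ?F" "x' \<noteq> x" for x'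
  proof -
    define z where "z j = vec_index x' j - vec_index x j" for j
    have x'N: "x' \<in> carrier_vec N" and ker: "\<forall>i<n. (\<Sum>j<N. measurement m \<Psi> h i j * z j) = 0"
      using x'(1) unfolding \<Gamma> bp_feasible_dict[OF \<Psi> h] z_def by auto
    have "\<exists>j<N. z j \<noteq> 0" using x'(2) x'N x(1) unfolding z_def by (metis carrier_vecD eq_iff_diff_eq_0 eq_vecI)
    then have z: "(\<Sum>j\<in>S. \<bar>z j\<bar>) < (\<Sum>j\<in>{..<N} - S. \<bar>z j\<bar>)"
      using nsp S ker unfolding null_space_property_def by blast
    have "l1_norm x = (\<Sum>j\<in>S. \<bar>vec_index x j\<bar>) + (\<Sum>j\<in>{..<N} - S. \<bar>vec_index x j\<bar>)"
      using x(1) S(1) by (simp add: l1_norm_def sum_split_subset)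
    also have "(\<Sum>j\<in>{..<N} - S. \<bar>vec_index x j\<bar>) = 0" by (intro sum.neutral) (auto simp: S_def)
    also have "(\<Sum>j\<in>S. \<bar>vec_index x j\<bar>) \<le> (\<Sum>j\<in>S. \<bar>vec_index x' j\<bar> + \<bar>z j\<bar>)"
      by (intro sum_mono) (auto simp: z_def)
    finally have "l1_norm x \<le> (\<Sum>j\<in>S. \<bar>vec_index x' j\<bar>) + (\<Sum>j\<in>S. \<bar>z j\<bar>)"
      by (simp add: sum.distrib)
    moreover have "(\<Sum>j\<in>{..<N} - S. \<bar>z j\<bar>) = (\<Sum>j\<in>{..<N} - S. \<bar>vec_index x' j\<bar>)"
      by (intro sum.cong) (auto simp: S_def z_def)
    ultimately show ?thesis using z x'N S(1) by (simp add: l1_norm_def sum_split_subset)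
  qed
  show "bp_solutions (dict_apply n N \<Psi> h) (\<Gamma> *\<^sub>v h) = {x}"
  proof (intro equalityI subsetI)
    fix x' assume "x' \<in> bp_solutions (dict_apply n N \<Psi> h) (\<Gamma> *\<^sub>v h)"
    then have "x' \<in> ?F" "l1_norm x' \<le> l1_norm x" using xF by (auto simp: bp_solutions_def)
    then show "x' \<in> {x}" using less by force
  qed (use xF less in \<open>force simp: bp_solutions_def\<close>)
qed

text \<open>This converse identifies the recovery event exactly with one whose measurability can be
  proved. If \<open>z\<close> violates the property on \<open>S\<close>, let \<open>x\<close> carry
  \<open>- z\<close> on \<open>S\<close>; then \<open>x + z\<close> trades that mass for the mass of
  \<open>z\<close> off \<open>S\<close> without increasing the l1-norm, so \<open>x\<close> is not
  the unique minimiser.\<close>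

lemma recovers_imp_null_space_property:
  assumes \<Psi>: "\<forall>j<N. \<Psi> j \<in> carrier_mat n m" and h: "h \<in> carrier_vec m"
    and rec: "bp_recovers_all_sparse n m N \<Psi> h k"
  shows "null_space_property n N k (measurement m \<Psi> h)"
  unfolding null_space_property_def
proof (intro allI impI, rule ccontr)
  fix S z assume S: "S \<subseteq> {..<N}" "card S = k" and ker: "\<forall>i<n. (\<Sum>j<N. measurement m \<Psi> h i j * z j) = 0"
    and nz: "\<exists>j<N. z j \<noteq> 0" and "\<not> (\<Sum>j\<in>S. \<bar>z j\<bar>) < (\<Sum>j\<in>{..<N} - S. \<bar>z j\<bar>)"
  then have le: "(\<Sum>j\<in>{..<N} - S. \<bar>z j\<bar>) \<le> (\<Sum>j\<in>S. \<bar>z j\<bar>)" by simp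
  \<comment> \<open>The entries 1 keep the support equal to \<open>S\<close>, since \<open>l0_norm\<close> is prescribed exactly.\<close>
  define x where "x = Matrix.vec N (\<lambda>j. if j \<in> S then (if z j = 0 then 1 else - z j) else 0)"
  define x' where "x' = Matrix.vec N (\<lambda>j. vec_index x j + z j)"
  have carr: "x \<in> carrier_vec N" "x' \<in> carrier_vec N" by (simp_all add: x_def x'_def)
  have xj: "vec_index x j = (if j \<in> S then (if z j = 0 then 1 else - z j) else 0)" if "j < N" for j
    using that by (simp add: x_def)
  have "{j. j < N \<and> vec_index x j \<noteq> 0} = S"
  proof (rule Set.set_eqI)
    show "j \<in> {j. j < N \<and> vec_index x j \<noteq> 0} \<longleftrightarrow> j \<in> S" for j
      using S(1) xj[of j] by (cases "j \<in> S") (auto split: if_splits)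
  qed
  then have "l0_norm x = k" using carr S(2) by (simp add: l0_norm_def)
  then have sol: "bp_solutions (dict_apply n N \<Psi> h) (dict_comb n m N \<Psi> x *\<^sub>v h) = {x}"
    using rec carr unfolding bp_recovers_all_sparse_def sparse_representation_def by blast
  have "(\<Sum>j<N. measurement m \<Psi> h i j * (vec_index x' j - vec_index x j)) =
      (\<Sum>j<N. measurement m \<Psi> h i j * z j)" for i
    by (intro sum.cong) (auto simp: x'_def)
  then have x'F: "x' \<in> bp_feasible (dict_apply n N \<Psi> h) (dict_comb n m N \<Psi> x *\<^sub>v h)"
    unfolding bp_feasible_dict[OF \<Psi> h] using carr ker by simp
  moreover have "l1_norm x' \<le> l1_norm x"
  proof -
    have "\<bar>vec_index x' j\<bar> = \<bar>vec_index x j\<bar> - \<bar>z j\<bar>" if "j \<in> S" for j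
      using that S(1) by (auto simp: x'_def x_def)
    then have "(\<Sum>j\<in>S. \<bar>vec_index x' j\<bar>) = (\<Sum>j\<in>S. \<bar>vec_index x j\<bar>) - (\<Sum>j\<in>S. \<bar>z j\<bar>)"
      by (simp add: sum_subtractf)
    moreover have "(\<Sum>j\<in>{..<N} - S. \<bar>vec_index x' j\<bar>) = (\<Sum>j\<in>{..<N} - S. \<bar>z j\<bar>)"
      by (intro sum.cong) (auto simp: x'_def x_def)
    moreover have "(\<Sum>j\<in>{..<N} - S. \<bar>vec_index x j\<bar>) = 0"
      by (intro sum.neutral) (auto simp: x_def)
    ultimately show ?thesis using carr S(1) le by (simp add: l1_norm_def sum_split_subset)
  qed
  moreover have "l1_norm x \<le> l1_norm u"
    if "u \<in> bp_feasible (dict_apply n N \<Psi> h) (dict_comb n m N \<Psi> x *\<^sub>v h)" for u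
    using sol that unfolding bp_solutions_def by blast
  ultimately have "x' \<in> bp_solutions (dict_apply n N \<Psi> h) (dict_comb n m N \<Psi> x *\<^sub>v h)"
    unfolding bp_solutions_def by (blast intro: order.trans)
  with sol have "x' = x" by simp
  obtain j where j: "j < N" "z j \<noteq> 0" using nz by blast
  then have "vec_index x' j = vec_index x j + z j" by (simp add: x'_def)
  with \<open>x' = x\<close> j show False by simp
qed

lemma recovers_iff_null_space_property:
  assumes "\<forall>j<N. \<Psi> j \<in> carrier_mat n m" "h \<in> carrier_vec m"
  shows "bp_recovers_all_sparse n m N \<Psi> h k \<longleftrightarrow> null_space_property n N k (measurement m \<Psi> h)"
  using null_space_property_imp_recovers[OF assms] recovers_imp_null_space_property[OF assms] by blast

lemma null_space_property_scale:
  assumes "c \<noteq> 0"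
  shows "null_space_property n N k (\<lambda>i j. c * A i j) \<longleftrightarrow> null_space_property n N k A"
  unfolding null_space_property_def using assms by (simp add: mult.assoc sum_distrib_left[symmetric])

text \<open>A violation puts at least half of the l1-mass on \<open>S\<close>, and Cauchy-Schwarz on
  the \<open>k\<close> indices of \<open>S\<close> brings in the factor
  \<open>sqrt k\<close>.\<close>

lemma flat_kernel_vector:
  assumes "\<not> null_space_property n N k A"
  obtains z where "\<And>i. i < n \<Longrightarrow> (\<Sum>j<N. A i j * z j) = 0" "\<exists>j<N. z j \<noteq> 0"
    "(\<Sum>j<N. \<bar>z j\<bar>) \<le> 2 * sqrt k * sqrt (\<Sum>j<N. (z j)\<^sup>2)"
proof -
  obtain S z where S: "S \<subseteq> {..<N}" "card S = k" and ker: "\<forall>i<n. (\<Sum>j<N. A i j * z j) = 0"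
    and nz: "\<exists>j<N. z j \<noteq> 0" and le: "\<not> (\<Sum>j\<in>S. \<bar>z j\<bar>) < (\<Sum>j\<in>{..<N} - S. \<bar>z j\<bar>)"
    using assms unfolding null_space_property_def by blast
  have "(\<Sum>j\<in>S. 1 * \<bar>z j\<bar>)\<^sup>2 \<le> (\<Sum>j\<in>S. 1\<^sup>2) * (\<Sum>j\<in>S. \<bar>z j\<bar>\<^sup>2)"
    by (rule Cauchy_Schwarz_ineq_sum)
  also have "\<dots> = k * (\<Sum>j\<in>S. (z j)\<^sup>2)" using S by simp
  also have "\<dots> \<le> k * (\<Sum>j<N. (z j)\<^sup>2)" using S by (intro mult_left_mono sum_mono2) auto
  finally have "(\<Sum>j\<in>S. \<bar>z j\<bar>) \<le> sqrt (k * (\<Sum>j<N. (z j)\<^sup>2))"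
    by (intro real_le_rsqrt) simp
  moreover have "(\<Sum>j<N. \<bar>z j\<bar>) \<le> 2 * (\<Sum>j\<in>S. \<bar>z j\<bar>)"
    using le S(1) by (simp add: sum_split_subset)
  ultimately show ?thesis using that[of z] ker nz by (simp add: real_sqrt_mult)
qed

section \<open>Measurability of the recovery event\<close>

text \<open>The uncountable existential is made countable: by compactness and continuity, a zero in
  \<open>K\<close> exists iff for every tolerance some point of a countable dense set is that close
  to \<open>K\<close> and has a value that close to 0.\<close>

lemma measurable_zero_on_compact:
  fixes f :: "'w \<Rightarrow> 'a::{metric_space, second_countable_topology} \<Rightarrow> real"
  assumes K: "compact K" and meas: "\<And>z. (\<lambda>\<omega>. f \<omega> z) \<in> borel_measurable M"
    and cont: "\<And>\<omega>. \<omega> \<in> space M \<Longrightarrow> continuous_on UNIV (f \<omega>)"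
  shows "{\<omega> \<in> space M. \<exists>z\<in>K. f \<omega> z = 0} \<in> sets M"
proof (cases "K = {}")
  case False
  obtain D :: "'a set" where D: "countable D" "\<And>X. open X \<Longrightarrow> X \<noteq> {} \<Longrightarrow> \<exists>d\<in>D. d \<in> X"
    by (rule countable_dense_setE) blast
  define e :: "nat \<Rightarrow> real" where "e q = inverse (Suc q)" for q
  have e: "e q > 0" for q by (simp add: e_def)
  have eq: "(\<exists>z\<in>K. f \<omega> z = 0) \<longleftrightarrow> (\<forall>q. \<exists>d\<in>D. infdist d K < e q \<and> \<bar>f \<omega> d\<bar> < e q)"
    if \<omega>: "\<omega> \<in> space M" for \<omega>
  proof
    assume "\<exists>z\<in>K. f \<omega> z = 0"
    then obtain z where z: "z \<in> K" "f \<omega> z = 0" by auto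
    show "\<forall>q. \<exists>d\<in>D. infdist d K < e q \<and> \<bar>f \<omega> d\<bar> < e q"
    proof
      fix q
      \<comment> \<open>\<open>K\<close> may contain no point of \<open>D\<close>, hence the passage
        to an open neighbourhood of \<open>K\<close>.\<close>
      have "open {d. infdist d K < e q \<and> \<bar>f \<omega> d\<bar> < e q}"
        by (intro open_Collect_conj open_Collect_less continuous_intros cont[OF \<omega>])
      moreover have "z \<in> {d. infdist d K < e q \<and> \<bar>f \<omega> d\<bar> < e q}" using z e by simp
      ultimately show "\<exists>d\<in>D. infdist d K < e q \<and> \<bar>f \<omega> d\<bar> < e q" using D(2) by blast
    qed
  next
    assume "\<forall>q. \<exists>d\<in>D. infdist d K < e q \<and> \<bar>f \<omega> d\<bar> < e q"
    then obtain d where d: "\<And>q. infdist (d q) K < e q" "\<And>q. \<bar>f \<omega> (d q)\<bar> < e q" by metis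
    have "\<exists>y\<in>K. dist (d q) y < e q" for q
      using d(1)[of q] False by (simp add: infdist_notempty cINF_less_iff)
    then obtain y where y: "\<And>q. y q \<in> K" "\<And>q. dist (d q) (y q) < e q" by metis
    obtain l s where l: "l \<in> K" "strict_mono s" "(y \<circ> s) \<longlonglongrightarrow> l"
      using K y(1) unfolding compact_def by metis
    have "e \<longlonglongrightarrow> 0" unfolding e_def by (rule LIMSEQ_inverse_real_of_nat)
    then have es: "(e \<circ> s) \<longlonglongrightarrow> 0" using l(2) by (rule LIMSEQ_subseq_LIMSEQ)
    have "(\<lambda>q. dist (d (s q)) (y (s q))) \<longlonglongrightarrow> 0"
      using tendsto_sandwich[OF _ _ tendsto_const es, of "\<lambda>q. dist (d (s q)) (y (s q))"] y(2)
      by (simp add: less_imp_le)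
    moreover have "(\<lambda>q. dist (y (s q)) l) \<longlonglongrightarrow> 0" 
      using tendsto_dist_iff[THEN iffD1, OF l(3)] by (simp only: comp_def)
    ultimately have "(\<lambda>q. dist (d (s q)) (y (s q)) + dist (y (s q)) l) \<longlonglongrightarrow> 0"
      using tendsto_add_zero by fast
    from tendsto_sandwich[OF _ _ tendsto_const this, of "\<lambda>q. dist (d (s q)) l"]
    have "(\<lambda>q. dist (d (s q)) l) \<longlonglongrightarrow> 0" by (simp add: dist_triangle)
    then have ds: "(\<lambda>q. d (s q)) \<longlonglongrightarrow> l" by (rule tendsto_dist_iff[THEN iffD2])
    have "isCont (f \<omega>) l" using cont[OF \<omega>] by (simp add: continuous_on_eq_continuous_at)
    then have "(\<lambda>q. f \<omega> (d (s q))) \<longlonglongrightarrow> f \<omega> l" using ds by (rule isCont_tendsto_compose)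
    moreover have "(\<lambda>q. \<bar>f \<omega> (d (s q))\<bar>) \<longlonglongrightarrow> 0"
      using tendsto_sandwich[OF _ _ tendsto_const es, of "\<lambda>q. \<bar>f \<omega> (d (s q))\<bar>"] d(2)
      by (simp add: less_imp_le)
    then have "(\<lambda>q. f \<omega> (d (s q))) \<longlonglongrightarrow> 0" by (rule tendsto_rabs_zero_cancel)
    ultimately show "\<exists>z\<in>K. f \<omega> z = 0" using l(1) LIMSEQ_unique by blast
  qed
  have [measurable]: "(\<lambda>\<omega>. f \<omega> z) \<in> borel_measurable M" for z by (rule meas)
  note [measurable] = D(1)
  have "{\<omega> \<in> space M. \<exists>z\<in>K. f \<omega> z = 0} =
      {\<omega> \<in> space M. \<forall>q. \<exists>d\<in>D. infdist d K < e q \<and> \<bar>f \<omega> d\<bar> < e q}"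
    using eq by blast
  also have "\<dots> \<in> sets M" by measurable
  finally show ?thesis .
qed simp

text \<open>Not a formality: \<open>measure\<close> is 0 on non-measurable sets, and the event quantifies over
  uncountably many vectors.\<close>

lemma measurable_null_space_property:
  fixes A :: "'w \<Rightarrow> nat \<Rightarrow> nat \<Rightarrow> real"
  assumes meas: "\<And>i j. i < n \<Longrightarrow> j < N \<Longrightarrow> (\<lambda>\<omega>. A \<omega> i j) \<in> borel_measurable M"
  shows "{\<omega> \<in> space M. null_space_property n N k (A \<omega>)} \<in> sets M"
proof -
  \<comment> \<open>The cube over all indices, also those from \<open>N\<close> on, is compact in
    the product topology by Tychonoff's theorem.\<close>
  define C :: "(nat \<Rightarrow> real) set" where "C = PiE UNIV (\<lambda>_. {- 1..1})"
  \<comment> \<open>Normalising the l1-norm to 1 excludes the zero vector, and the negated strict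
    inequality is a closed condition, so \<open>K S\<close> is compact.\<close>
  define K where "K S = C \<inter> {z. (\<Sum>j<N. \<bar>z j\<bar>) = 1 \<and> (\<Sum>j\<in>{..<N} - S. \<bar>z j\<bar>) \<le> (\<Sum>j\<in>S. \<bar>z j\<bar>)}" for S
  define f where "f \<omega> z = (\<Sum>i<n. \<bar>\<Sum>j<N. A \<omega> i j * z j\<bar>)" for \<omega> and z :: "nat \<Rightarrow> real"
  have coord: "continuous_on UNIV (\<lambda>z::nat \<Rightarrow> real. z j)" for j by (rule continuous_on_product_coordinates)
  have "compact C"
    using compactin_PiE[of "\<lambda>_::nat. euclideanreal" UNIV "\<lambda>_. {- 1..1}"]
    by (simp add: C_def euclidean_product_topology)
  then have K: "compact (K S)" for S
    unfolding K_def by (intro compact_Int_closed closed_Collect_conj closed_Collect_le closed_Collect_eq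
        continuous_intros coord)
  have f0: "f \<omega> z = 0 \<longleftrightarrow> (\<forall>i<n. (\<Sum>j<N. A \<omega> i j * z j) = 0)" for \<omega> z
    unfolding f_def by (subst sum_nonneg_eq_0_iff) auto
  have iff: "null_space_property n N k (A \<omega>) \<longleftrightarrow>
      (\<forall>S\<in>{S\<in>Pow {..<N}. card S = k}. \<not> (\<exists>z\<in>K S. f \<omega> z = 0))" (is "_ \<longleftrightarrow> ?R") for \<omega>
  proof
    assume nsp: "null_space_property n N k (A \<omega>)"
    show ?R
    proof safe
      fix S z assume S: "S \<subseteq> {..<N}" "k = card S" and z: "z \<in> K S" and "f \<omega> z = 0"
      then have "\<forall>i<n. (\<Sum>j<N. A \<omega> i j * z j) = 0" by (simp add: f0)
      moreover have "\<exists>j<N. z j \<noteq> 0"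
      proof (rule ccontr)
        assume "\<not> ?thesis"
        then have "(\<Sum>j<N. \<bar>z j\<bar>) = 0" by simp
        with z show False by (simp add: K_def)
      qed
      ultimately have "(\<Sum>j\<in>S. \<bar>z j\<bar>) < (\<Sum>j\<in>{..<N} - S. \<bar>z j\<bar>)"
        using nsp S unfolding null_space_property_def by blast
      with z show False by (simp add: K_def)
    qed
  next
    assume R: ?R
    show "null_space_property n N k (A \<omega>)"
      unfolding null_space_property_def
    proof (intro allI impI, rule ccontr)
      fix S z assume S: "S \<subseteq> {..<N}" "card S = k" and ker: "\<forall>i<n. (\<Sum>j<N. A \<omega> i j * z j) = 0"
        and nz: "\<exists>j<N. z j \<noteq> 0" and le: "\<not> (\<Sum>j\<in>S. \<bar>z j\<bar>) < (\<Sum>j\<in>{..<N} - S. \<bar>z j\<bar>)"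
      define b where "b = (\<Sum>j<N. \<bar>z j\<bar>)"
      obtain j0 where "j0 < N" "z j0 \<noteq> 0" using nz by auto
      then have b: "b > 0" unfolding b_def by (intro sum_pos2[of _ j0]) auto
      \<comment> \<open>Entries from \<open>N\<close> on are set to 0 to land in the cube; no sum in
        question involves them.\<close>
      define z' where "z' j = (if j < N then z j / b else 0)" for j
      have sum_z': "(\<Sum>j\<in>T. \<bar>z' j\<bar>) = (\<Sum>j\<in>T. \<bar>z j\<bar>) / b" if "T \<subseteq> {..<N}" for T
        unfolding sum_divide_distrib using that b by (intro sum.cong) (auto simp: z'_def)
      have "\<bar>z j\<bar> \<le> b" if "j < N" for j
        unfolding b_def using that by (intro member_le_sum) auto
      then have "\<bar>z' j\<bar> \<le> 1" for j
        using b by (simp add: z'_def)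
      then have "- 1 \<le> z' j \<and> z' j \<le> 1" for j
        by (smt (verit))
      then have "z' \<in> C" by (simp add: C_def PiE_iff)
      moreover have "(\<Sum>j<N. \<bar>z' j\<bar>) = 1" using sum_z'[of "{..<N}"] b by (simp add: b_def)
      moreover have "(\<Sum>j\<in>{..<N} - S. \<bar>z' j\<bar>) \<le> (\<Sum>j\<in>S. \<bar>z' j\<bar>)"
        using le S(1) b by (simp add: sum_z' divide_right_mono)
      ultimately have "z' \<in> K S" by (simp add: K_def)
      moreover have "(\<Sum>j<N. A \<omega> i j * z' j) = (\<Sum>j<N. A \<omega> i j * z j) / b" for i
        unfolding sum_divide_distrib by (intro sum.cong) (auto simp: z'_def)
      then have "f \<omega> z' = 0" using ker by (simp add: f0)
      ultimately show False using R S by blast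
    qed
  qed
  have "{\<omega> \<in> space M. \<exists>z\<in>K S. f \<omega> z = 0} \<in> sets M" for S
  proof (rule measurable_zero_on_compact[OF K])
    show "(\<lambda>\<omega>. f \<omega> z) \<in> borel_measurable M" for z
      unfolding f_def using meas by (intro borel_measurable_sum borel_measurable_abs borel_measurable_times) auto
    show "continuous_on UNIV (f \<omega>)" for \<omega>
      unfolding f_def by (intro continuous_intros coord)
  qed
  then have "{\<omega> \<in> space M. \<not> (\<exists>z\<in>K S. f \<omega> z = 0)} \<in> sets M" for S
    by (rule sets.sets_Collect_neg)
  then show ?thesis unfolding iff by (intro sets.sets_Collect_finite_All) auto
qed


section \<open>Subgaussian rows\<close>

text \<open>With a nonnegative integral the exponential bound includes finiteness, so integrability
  follows from it instead of being a separate condition.\<close>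

definition std_subgaussian :: "'w measure \<Rightarrow> ('w \<Rightarrow> real) \<Rightarrow> bool" where
  "std_subgaussian M X \<longleftrightarrow> X \<in> borel_measurable M \<and>
     (\<forall>t. (\<integral>\<^sup>+\<omega>. ennreal (exp (t * X \<omega>)) \<partial>M) \<le> ennreal (exp (t\<^sup>2 / 2))) \<and>
     (\<integral>\<omega>. X \<omega> \<partial>M) = 0 \<and> (\<integral>\<omega>. (X \<omega>)\<^sup>2 \<partial>M) = 1"

text \<open>One term of the exponential series at \<open>2 * \<bar>x\<bar>\<close> is at most the
  whole sum. The factor 2 later gives a fourth moment of at most
  \<open>3 * exp 2 <= 24\<close>.\<close>

lemma power_le_exp_sum:
  fixes x :: real
  shows "\<bar>x\<bar> ^ p \<le> fact p / 2 ^ p * (exp (2 * x) + exp (- 2 * x))"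
proof -
  define y where "y = 2 * \<bar>x\<bar>"
  have "y ^ p / fact p = (\<Sum>k\<in>{p}. y ^ k /\<^sub>R fact k)" by (simp add: field_simps)
  also have "\<dots> \<le> (\<Sum>k. y ^ k /\<^sub>R fact k)"
    by (intro sum_le_suminf summable_exp_generic) (auto simp: y_def)
  finally have "y ^ p / fact p \<le> exp y" by (simp add: exp_def)
  also have "\<dots> \<le> exp (2 * x) + exp (- 2 * x)" by (cases "x \<ge> 0") (simp_all add: y_def)
  finally show ?thesis by (simp add: y_def power_mult_distrib field_simps)
qed

text \<open>The lower Taylor bound for \<open>exp y\<close> is inverted, using
  \<open>(1 + y + y^2 / 2) (1 - y + y^2 / 2) = 1 + y^4 / 4\<close>.\<close>

lemma exp_minus_le_quadratic:
  fixes y :: real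
  assumes "y \<ge> 0"
  shows "exp (- y) \<le> 1 - y + y\<^sup>2 / 2"
proof -
  have "1 \<le> (1 + y + y\<^sup>2 / 2) * (1 - y + y\<^sup>2 / 2)"
  proof -
    have "(1 + y + y\<^sup>2 / 2) * (1 - y + y\<^sup>2 / 2) = 1 + (y\<^sup>2)\<^sup>2 / 4"
      by (simp add: power2_eq_square field_simps)
    then show ?thesis by simp
  qed
  also have "\<dots> \<le> exp y * (1 - y + y\<^sup>2 / 2)"
  proof (rule mult_right_mono)
    have "1 - y + y\<^sup>2 / 2 = (1 + (1 - y)\<^sup>2) / 2" by (simp add: power2_eq_square field_simps)
    also have "\<dots> \<ge> 0" by simp
    finally show "0 \<le> 1 - y + y\<^sup>2 / 2" .
  qed (use exp_lower_Taylor_quadratic[OF assms] in simp)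
  finally show ?thesis by (simp add: exp_minus field_simps)
qed

lemma nn_integral_normal_density:
  assumes "\<sigma> > 0"
  shows "(\<integral>\<^sup>+x. ennreal (normal_density \<mu> \<sigma> x) \<partial>lborel) = 1"
  using assms by (subst nn_integral_eq_integral) (auto simp: normal_density_nonneg)

context prob_space
begin

lemma std_subgaussian_measurable: "std_subgaussian M X \<Longrightarrow> X \<in> borel_measurable M"
  by (simp add: std_subgaussian_def)

lemma std_subgaussian_exp:
  assumes "std_subgaussian M X"
  shows "integrable M (\<lambda>\<omega>. exp (t * X \<omega>))" "expectation (\<lambda>\<omega>. exp (t * X \<omega>)) \<le> exp (t\<^sup>2 / 2)"
proof -
  have [measurable]: "X \<in> borel_measurable M"
    and le: "(\<integral>\<^sup>+\<omega>. ennreal (exp (t * X \<omega>)) \<partial>M) \<le> ennreal (exp (t\<^sup>2 / 2))"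
    using assms by (auto simp: std_subgaussian_def)
  show int: "integrable M (\<lambda>\<omega>. exp (t * X \<omega>))"
    by (rule integrableI_nonneg) (auto intro: order.strict_trans1[OF le])
  have "ennreal (expectation (\<lambda>\<omega>. exp (t * X \<omega>))) \<le> ennreal (exp (t\<^sup>2 / 2))"
    using le by (subst nn_integral_eq_integral[OF int, symmetric]) auto
  then show "expectation (\<lambda>\<omega>. exp (t * X \<omega>)) \<le> exp (t\<^sup>2 / 2)" by simp
qed

lemma std_subgaussian_power:
  assumes X: "std_subgaussian M X"
  shows "integrable M (\<lambda>\<omega>. (X \<omega>) ^ p)" "expectation (\<lambda>\<omega>. \<bar>X \<omega>\<bar> ^ p) \<le> 2 * fact p / 2 ^ p * exp 2"
proof -
  have [measurable]: "X \<in> borel_measurable M" using X by (rule std_subgaussian_measurable)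
  let ?B = "\<lambda>\<omega>. fact p / 2 ^ p * (exp (2 * X \<omega>) + exp (- 2 * X \<omega>))"
  have int: "integrable M ?B"
    using std_subgaussian_exp(1)[OF X, of 2] std_subgaussian_exp(1)[OF X, of "- 2"]
    by (intro integrable_mult_right Bochner_Integration.integrable_add)
  show "integrable M (\<lambda>\<omega>. (X \<omega>) ^ p)"
    using int
  proof (rule Bochner_Integration.integrable_bound)
    show "AE \<omega> in M. norm (X \<omega> ^ p) \<le> norm (?B \<omega>)"
      using power_le_exp_sum[of "X _" p] by (auto simp: power_abs abs_mult intro!: AE_I2)
  qed simp
  then have "integrable M (\<lambda>\<omega>. \<bar>X \<omega> ^ p\<bar>)" by (rule integrable_abs)
  then have "integrable M (\<lambda>\<omega>. \<bar>X \<omega>\<bar> ^ p)" by (simp only: power_abs)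
  then have "expectation (\<lambda>\<omega>. \<bar>X \<omega>\<bar> ^ p) \<le> expectation ?B"
    using int
  proof (rule integral_mono)
    show "\<bar>X \<omega>\<bar> ^ p \<le> ?B \<omega>" for \<omega> by (rule power_le_exp_sum)
  qed
  also have "\<dots> = fact p / 2 ^ p * (expectation (\<lambda>\<omega>. exp (2 * X \<omega>)) + expectation (\<lambda>\<omega>. exp (- 2 * X \<omega>)))"
    by (simp only: integral_mult_right_zero
        Bochner_Integration.integral_add[OF std_subgaussian_exp(1)[OF X] std_subgaussian_exp(1)[OF X]])
  also have "\<dots> \<le> fact p / 2 ^ p * (exp 2 + exp 2)"
    using std_subgaussian_exp(2)[OF X, of 2] std_subgaussian_exp(2)[OF X, of "- 2"]
    by (intro mult_left_mono add_mono) auto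
  finally show "expectation (\<lambda>\<omega>. \<bar>X \<omega>\<bar> ^ p) \<le> 2 * fact p / 2 ^ p * exp 2" by (simp add: mult_ac)
qed

text \<open>Independence factorises the exponential moments and makes the mixed second moments
  vanish; the unit length of \<open>b\<close> then keeps the subgaussian parameter and the variance
  at 1.\<close>

lemma std_subgaussian_sum:
  fixes b :: "'i \<Rightarrow> real"
  assumes I: "finite I" and ind: "indep_vars (\<lambda>_. borel) \<xi> I"
    and \<xi>: "\<And>e. e \<in> I \<Longrightarrow> std_subgaussian M (\<xi> e)" and b: "(\<Sum>e\<in>I. (b e)\<^sup>2) = 1"
  shows "std_subgaussian M (\<lambda>\<omega>. \<Sum>e\<in>I. b e * \<xi> e \<omega>)"
  unfolding std_subgaussian_def
proof (intro conjI allI)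
  have meas[measurable]: "\<xi> e \<in> borel_measurable M" if "e \<in> I" for e
    using \<xi>[OF that] by (rule std_subgaussian_measurable)
  have int: "integrable M (\<xi> e)" if "e \<in> I" for e
    using std_subgaussian_power(1)[OF \<xi>[OF that], of 1] by simp
  have mean: "expectation (\<xi> e) = 0" if "e \<in> I" for e
    using \<xi>[OF that] by (simp add: std_subgaussian_def)
  show "(\<lambda>\<omega>. \<Sum>e\<in>I. b e * \<xi> e \<omega>) \<in> borel_measurable M"
    by (intro borel_measurable_sum borel_measurable_times meas) auto
  show "expectation (\<lambda>\<omega>. \<Sum>e\<in>I. b e * \<xi> e \<omega>) = 0"
    using int mean by (subst Bochner_Integration.integral_sum) auto
  fix t :: real
  have "(\<integral>\<^sup>+\<omega>. ennreal (exp (t * (\<Sum>e\<in>I. b e * \<xi> e \<omega>))) \<partial>M) =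
      (\<integral>\<^sup>+\<omega>. (\<Prod>e\<in>I. ennreal (exp (t * b e * \<xi> e \<omega>))) \<partial>M)"
    using I by (simp add: sum_distrib_left exp_sum prod_ennreal mult.assoc)
  also have "\<dots> = (\<Prod>e\<in>I. \<integral>\<^sup>+\<omega>. ennreal (exp (t * b e * \<xi> e \<omega>)) \<partial>M)"
    by (intro indep_vars_nn_integral I indep_vars_compose2[OF ind]) auto
  also have "\<dots> \<le> (\<Prod>e\<in>I. ennreal (exp ((t * b e)\<^sup>2 / 2)))"
    using \<xi> by (intro prod_mono_ennreal) (simp add: std_subgaussian_def)
  also have "\<dots> = ennreal (exp (\<Sum>e\<in>I. (t * b e)\<^sup>2 / 2))"
    using I by (simp add: exp_sum prod_ennreal)
  also have "(\<Sum>e\<in>I. (t * b e)\<^sup>2 / 2) = t\<^sup>2 / 2"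
    using b by (simp add: power_mult_distrib sum_divide_distrib[symmetric] sum_distrib_left[symmetric])
  finally show "(\<integral>\<^sup>+\<omega>. ennreal (exp (t * (\<Sum>e\<in>I. b e * \<xi> e \<omega>))) \<partial>M) \<le> ennreal (exp (t\<^sup>2 / 2))" .
next
  have \<xi>2: "integrable M (\<lambda>\<omega>. \<xi> e \<omega> * \<xi> e' \<omega>)"
    and cov: "expectation (\<lambda>\<omega>. \<xi> e \<omega> * \<xi> e' \<omega>) = (if e = e' then 1 else 0)"
    if e: "e \<in> I" "e' \<in> I" for e e'
  proof -
    have "integrable M (\<lambda>\<omega>. \<xi> e \<omega> * \<xi> e' \<omega>) \<and>
        expectation (\<lambda>\<omega>. \<xi> e \<omega> * \<xi> e' \<omega>) = (if e = e' then 1 else 0)"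
    proof (cases "e = e'")
      case True
      then show ?thesis
        using std_subgaussian_power(1)[OF \<xi>[OF e(1)], of 2] \<xi>[OF e(1)]
        by (simp add: power2_eq_square std_subgaussian_def)
    next
      case False
      have ind2: "indep_vars (\<lambda>_. borel) \<xi> {e, e'}" using indep_vars_subset[OF ind] e by auto
      have int: "integrable M (\<xi> f)" if "f \<in> {e, e'}" for f
        using std_subgaussian_power(1)[OF \<xi>, of f 1] that e by auto
      show ?thesis
        using indep_vars_integrable[OF _ ind2 int] indep_vars_lebesgue_integral[OF _ ind2 int] False
          \<xi>[OF e(1)] by (simp add: std_subgaussian_def)
    qed
    then show "integrable M (\<lambda>\<omega>. \<xi> e \<omega> * \<xi> e' \<omega>)"
      "expectation (\<lambda>\<omega>. \<xi> e \<omega> * \<xi> e' \<omega>) = (if e = e' then 1 else 0)" by auto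
  qed
  have "expectation (\<lambda>\<omega>. (\<Sum>e\<in>I. b e * \<xi> e \<omega>)\<^sup>2) =
      expectation (\<lambda>\<omega>. \<Sum>e\<in>I. \<Sum>e'\<in>I. b e * b e' * (\<xi> e \<omega> * \<xi> e' \<omega>))"
    by (simp add: power2_eq_square sum_product mult_ac)
  also have "\<dots> = (\<Sum>e\<in>I. \<Sum>e'\<in>I. b e * b e' * expectation (\<lambda>\<omega>. \<xi> e \<omega> * \<xi> e' \<omega>))"
    using \<xi>2 by (subst Bochner_Integration.integral_sum; simp add: Bochner_Integration.integral_sum)
  also have "\<dots> = (\<Sum>e\<in>I. \<Sum>e'\<in>I. if e = e' then b e * b e' else 0)"
    by (intro sum.cong refl) (auto simp: cov)
  also have "\<dots> = 1" using I b by (simp add: power2_eq_square)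
  finally show "expectation (\<lambda>\<omega>. (\<Sum>e\<in>I. b e * \<xi> e \<omega>)\<^sup>2) = 1" .
qed

section \<open>Exponential moments of squares and tail bounds\<close>

text \<open>With second moment 1 and fourth moment at most 24, the quadratic bound for
  \<open>exp (- \<theta> x^2)\<close> has mean at most \<open>1 - \<theta> + 12 \<theta>^2\<close>.
  This is minimal at \<open>\<theta> = 1 / 24\<close>, with value \<open>1 - 1 / 48\<close>.\<close>

lemma std_subgaussian_exp_minus_square:
  assumes X: "std_subgaussian M X"
  shows "(\<integral>\<^sup>+\<omega>. ennreal (exp (- (1 / 24) * (X \<omega>)\<^sup>2)) \<partial>M) \<le> ennreal (exp (- (1 / 48)))"
proof -
  have [measurable]: "X \<in> borel_measurable M" using X by (rule std_subgaussian_measurable)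
  have int: "integrable M (\<lambda>\<omega>. exp (- (1 / 24) * (X \<omega>)\<^sup>2))"
    by (rule integrable_const_bound[where B = 1]) auto
  have 2: "integrable M (\<lambda>\<omega>. (X \<omega>)\<^sup>2)" and 4: "integrable M (\<lambda>\<omega>. (X \<omega>) ^ 4)"
    using std_subgaussian_power(1)[OF X] by auto
  have "exp (2::real) \<le> 8"
  proof -
    have "exp (2::real) = (exp 1)\<^sup>2" by (simp add: exp_double[symmetric])
    also have "\<dots> \<le> 2.8\<^sup>2" using e_less_272 by (intro power_mono) auto
    finally show ?thesis by (simp add: power2_eq_square)
  qed
  then have E4: "expectation (\<lambda>\<omega>. (X \<omega>) ^ 4) \<le> 24"
    using std_subgaussian_power(2)[OF X, of 4] by (simp add: fact_numeral)
  have "expectation (\<lambda>\<omega>. exp (- (1 / 24) * (X \<omega>)\<^sup>2)) \<le>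
      expectation (\<lambda>\<omega>. 1 - (1 / 24) * (X \<omega>)\<^sup>2 + (1 / 1152) * (X \<omega>) ^ 4)"
  proof (rule integral_mono[OF int])
    show "integrable M (\<lambda>\<omega>. 1 - (1 / 24) * (X \<omega>)\<^sup>2 + (1 / 1152) * (X \<omega>) ^ 4)"
      using 2 4 by simp
    show "exp (- (1 / 24) * (X \<omega>)\<^sup>2) \<le> 1 - (1 / 24) * (X \<omega>)\<^sup>2 + (1 / 1152) * (X \<omega>) ^ 4" for \<omega>
      using exp_minus_le_quadratic[of "(X \<omega>)\<^sup>2 / 24"] by (simp add: power2_eq_square power4_eq_xxxx field_simps)
  qed
  also have "\<dots> = 1 - 1 / 24 + (1 / 1152) * expectation (\<lambda>\<omega>. (X \<omega>) ^ 4)"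
    using X 2 4 by (simp add: std_subgaussian_def prob_space)
  also have "\<dots> \<le> 1 + (- (1 / 48))" using E4 by simp
  also have "\<dots> \<le> exp (- (1 / 48))" by (rule exp_ge_add_one_self)
  finally show ?thesis by (subst nn_integral_eq_integral[OF int]) auto
qed

text \<open>Writing \<open>exp (x\<^sup>2 / 4)\<close> as the Laplace transform of a normal variable reduces
  the bound to the moment generating function of \<open>X\<close>.\<close>

lemma std_subgaussian_exp_square:
  assumes X: "std_subgaussian M X"
  shows "(\<integral>\<^sup>+\<omega>. ennreal (exp (1 / 4 * (X \<omega>)\<^sup>2)) \<partial>M) \<le> ennreal (exp 1)"
proof -
  interpret P: pair_sigma_finite M lborel ..
  have [measurable]: "X \<in> borel_measurable M" using X by (rule std_subgaussian_measurable)
  let ?s = "1 / sqrt 2 :: real"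
  \<comment> \<open>Completing the square. The factor \<open>1 / sqrt 2\<close> makes the mean of
    \<open>exp (?s * g * x)\<close> over a standard normal \<open>g\<close> equal to
    \<open>exp (x^2 / 4)\<close>.\<close>
  have "std_normal_density g * exp (?s * g * x) = exp (1 / 4 * x\<^sup>2) * normal_density (?s * x) 1 g" for g x
  proof -
    have "(g - ?s * x)\<^sup>2 = g\<^sup>2 - 2 * (?s * g * x) + x\<^sup>2 / 2"
      by (simp add: power2_diff power_mult_distrib power_divide field_simps)
    then have "1 / 4 * x\<^sup>2 + - (g - ?s * x)\<^sup>2 / 2 = - g\<^sup>2 / 2 + ?s * g * x" by (simp add: field_simps)
    then show ?thesis
      by (simp add: normal_density_def exp_add[symmetric])
  qed
  note shift = this
  have "ennreal (exp (1 / 4 * x\<^sup>2)) =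
      (\<integral>\<^sup>+g. ennreal (std_normal_density g) * ennreal (exp (?s * g * x)) \<partial>lborel)" for x
    unfolding ennreal_mult'[OF exp_ge_zero, symmetric]
    by (simp only: ennreal_mult''[OF exp_ge_zero, symmetric] shift)
      (simp add: ennreal_mult' nn_integral_cmult nn_integral_normal_density)
  then have "(\<integral>\<^sup>+\<omega>. ennreal (exp (1 / 4 * (X \<omega>)\<^sup>2)) \<partial>M) =
      (\<integral>\<^sup>+\<omega>. (\<integral>\<^sup>+g. ennreal (std_normal_density g) * ennreal (exp (?s * g * X \<omega>)) \<partial>lborel) \<partial>M)"
    by simp
  also have "\<dots> = (\<integral>\<^sup>+g. (\<integral>\<^sup>+\<omega>. ennreal (std_normal_density g) * ennreal (exp (?s * g * X \<omega>)) \<partial>M) \<partial>lborel)"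
    by (rule P.Fubini'[symmetric]) measurable
  also have "\<dots> \<le> (\<integral>\<^sup>+g. ennreal (sqrt 2) * ennreal (normal_density 0 (sqrt 2) g) \<partial>lborel)"
  proof (rule nn_integral_mono)
    fix g :: real
    have "(\<integral>\<^sup>+\<omega>. ennreal (std_normal_density g) * ennreal (exp (?s * g * X \<omega>)) \<partial>M) =
        ennreal (std_normal_density g) * (\<integral>\<^sup>+\<omega>. ennreal (exp (?s * g * X \<omega>)) \<partial>M)"
      by (rule nn_integral_cmult) measurable
    also have "\<dots> \<le> ennreal (std_normal_density g) * ennreal (exp ((?s * g)\<^sup>2 / 2))"
      using X[unfolded std_subgaussian_def, THEN conjunct2, THEN conjunct1, rule_format, of "?s * g"]
      by (rule mult_left_mono) simp
    also have "\<dots> = ennreal (std_normal_density g * exp ((?s * g)\<^sup>2 / 2))"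
      by (simp add: ennreal_mult'')
    \<comment> \<open>Half of the Gaussian decay survives, which leaves a normal density of variance
      2; with 1/2 in place of 1/4 all decay would cancel.\<close>
    also have "std_normal_density g * exp ((?s * g)\<^sup>2 / 2) = sqrt 2 * normal_density 0 (sqrt 2) g"
    proof -
      have "- g\<^sup>2 / 2 + (?s * g)\<^sup>2 / 2 = - g\<^sup>2 / 4" by (simp add: power_mult_distrib power_divide)
      then show ?thesis
        by (simp add: normal_density_def exp_add[symmetric] real_sqrt_mult) (simp add: field_simps)
    qed
    finally show "(\<integral>\<^sup>+\<omega>. ennreal (std_normal_density g) * ennreal (exp (?s * g * X \<omega>)) \<partial>M) \<le>
        ennreal (sqrt 2) * ennreal (normal_density 0 (sqrt 2) g)"
      by (simp add: ennreal_mult)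
  qed
  also have "\<dots> = ennreal (sqrt 2)"
    by (simp add: nn_integral_cmult nn_integral_normal_density)
  also have "\<dots> \<le> ennreal (exp 1)"
  proof (rule ennreal_leI)
    have "sqrt 2 \<le> (2::real)" by (rule real_le_lsqrt) auto
    also have "\<dots> \<le> exp 1" using exp_ge_add_one_self[of 1] by simp
    finally show "sqrt 2 \<le> exp 1" .
  qed
  finally show ?thesis .
qed

text \<open>Markov's inequality for the exponential, factorised by independence. The sign of
  \<theta> is left open: negative values give lower tails, positive ones upper tails.\<close>

lemma chernoff_sum_squares:
  fixes n :: nat and \<theta> \<kappa> s :: real
  assumes ind: "indep_vars (\<lambda>_. borel) X {..<n}"
    and le: "\<And>i. i < n \<Longrightarrow> (\<integral>\<^sup>+\<omega>. ennreal (exp (\<theta> * (X i \<omega>)\<^sup>2)) \<partial>M) \<le> ennreal (exp \<kappa>)"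
  shows "prob {\<omega> \<in> space M. s \<le> \<theta> * (\<Sum>i<n. (X i \<omega>)\<^sup>2)} \<le> exp (n * \<kappa> - s)"
proof -
  have meas[measurable]: "X i \<in> borel_measurable M" if "i \<in> {..<n}" for i
    using ind that by (auto simp: indep_vars_def)
  have [measurable]: "(\<lambda>\<omega>. \<Sum>i<n. (X i \<omega>)\<^sup>2) \<in> borel_measurable M"
    by (intro borel_measurable_sum borel_measurable_power meas)
  have "emeasure M {\<omega> \<in> space M. s \<le> \<theta> * (\<Sum>i<n. (X i \<omega>)\<^sup>2)} =
      (\<integral>\<^sup>+\<omega>. indicator {\<omega> \<in> space M. s \<le> \<theta> * (\<Sum>i<n. (X i \<omega>)\<^sup>2)} \<omega> \<partial>M)"
    by (subst nn_integral_indicator) measurable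
  also have "\<dots> \<le> (\<integral>\<^sup>+\<omega>. ennreal (exp (- s)) * (\<Prod>i<n. ennreal (exp (\<theta> * (X i \<omega>)\<^sup>2))) \<partial>M)"
  proof (rule nn_integral_mono)
    fix \<omega>
    have "ennreal (exp (- s)) * (\<Prod>i<n. ennreal (exp (\<theta> * (X i \<omega>)\<^sup>2))) =
        ennreal (exp (\<theta> * (\<Sum>i<n. (X i \<omega>)\<^sup>2) - s))"
    proof -
      have "(\<Prod>i<n. ennreal (exp (\<theta> * (X i \<omega>)\<^sup>2))) = ennreal (exp (\<theta> * (\<Sum>i<n. (X i \<omega>)\<^sup>2)))"
        by (simp add: prod_ennreal exp_sum sum_distrib_left)
      then show ?thesis by (simp add: ennreal_mult'[symmetric] exp_add[symmetric])
    qed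
    moreover have "1 \<le> ennreal (exp (\<theta> * (\<Sum>i<n. (X i \<omega>)\<^sup>2) - s))" if "s \<le> \<theta> * (\<Sum>i<n. (X i \<omega>)\<^sup>2)"
      using that by simp
    ultimately show "indicator {\<omega> \<in> space M. s \<le> \<theta> * (\<Sum>i<n. (X i \<omega>)\<^sup>2)} \<omega> \<le>
        ennreal (exp (- s)) * (\<Prod>i<n. ennreal (exp (\<theta> * (X i \<omega>)\<^sup>2)))"
      by (auto simp: indicator_def)
  qed
  also have "\<dots> = ennreal (exp (- s)) * (\<integral>\<^sup>+\<omega>. (\<Prod>i<n. ennreal (exp (\<theta> * (X i \<omega>)\<^sup>2))) \<partial>M)"
    by (rule nn_integral_cmult) (intro borel_measurable_prod_ennreal, use meas in measurable)
  also have "(\<integral>\<^sup>+\<omega>. (\<Prod>i<n. ennreal (exp (\<theta> * (X i \<omega>)\<^sup>2))) \<partial>M) =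
      (\<Prod>i<n. \<integral>\<^sup>+\<omega>. ennreal (exp (\<theta> * (X i \<omega>)\<^sup>2)) \<partial>M)"
    by (intro indep_vars_nn_integral indep_vars_compose2[OF ind]) auto
  also have "ennreal (exp (- s)) * \<dots> \<le> ennreal (exp (- s)) * (\<Prod>i<n. ennreal (exp \<kappa>))"
    using le by (intro mult_left_mono prod_mono_ennreal) auto
  also have "\<dots> = ennreal (exp (n * \<kappa> - s))"
    by (simp add: ennreal_power ennreal_mult'[symmetric] exp_of_nat_mult[symmetric] exp_add[symmetric])
  finally show ?thesis by (simp add: emeasure_eq_measure)
qed

text \<open>Different rows are functions of disjoint blocks of independent entries.\<close>

lemma indep_rows:
  fixes c :: "nat \<Rightarrow> nat \<Rightarrow> real" and n N m :: nat
  assumes ind: "indep_vars (\<lambda>_. borel) \<xi> ({..<N} \<times> {..<n} \<times> {..<m})"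
  shows "indep_vars (\<lambda>_. borel) (\<lambda>i \<omega>. \<Sum>j<N. \<Sum>l<m. c j l * \<xi> (j, i, l) \<omega>) {..<n}"
proof -
  define K where "K i = {..<N} \<times> {i} \<times> {..<m}" for i :: nat
  have "indep_vars (\<lambda>i. PiM (K i) (\<lambda>_. borel)) (\<lambda>i \<omega>. restrict (\<lambda>e. \<xi> e \<omega>) (K i)) {..<n}"
    by (rule indep_vars_restrict[OF ind]) (auto simp: K_def disjoint_family_on_def)
  then have "indep_vars (\<lambda>_. borel)
      (\<lambda>i \<omega>. (\<lambda>f. \<Sum>j<N. \<Sum>l<m. c j l * f (j, i, l)) (restrict (\<lambda>e. \<xi> e \<omega>) (K i))) {..<n}"
  proof (rule indep_vars_compose2)
    show "(\<lambda>f. \<Sum>j<N. \<Sum>l<m. c j l * f (j, i, l)) \<in> borel_measurable (PiM (K i) (\<lambda>_. borel))" for i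
      by (intro borel_measurable_sum borel_measurable_times measurable_component_singleton) (auto simp: K_def)
  qed
  also have "(\<lambda>i \<omega>. (\<lambda>f. \<Sum>j<N. \<Sum>l<m. c j l * f (j, i, l)) (restrict (\<lambda>e. \<xi> e \<omega>) (K i))) =
      (\<lambda>i \<omega>. \<Sum>j<N. \<Sum>l<m. c j l * \<xi> (j, i, l) \<omega>)"
    by (intro ext sum.cong refl) (auto simp: K_def)
  finally show ?thesis .
qed

lemma std_subgaussian_row:
  fixes c :: "nat \<Rightarrow> nat \<Rightarrow> real" and n N m :: nat
  assumes ind: "indep_vars (\<lambda>_. borel) \<xi> ({..<N} \<times> {..<n} \<times> {..<m})"
    and \<xi>: "\<And>e. e \<in> {..<N} \<times> {..<n} \<times> {..<m} \<Longrightarrow> std_subgaussian M (\<xi> e)"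
    and c: "(\<Sum>j<N. \<Sum>l<m. (c j l)\<^sup>2) = 1" and i: "i < n"
  shows "std_subgaussian M (\<lambda>\<omega>. \<Sum>j<N. \<Sum>l<m. c j l * \<xi> (j, i, l) \<omega>)"
proof -
  let ?I = "{..<N} \<times> {i} \<times> {..<m}"
  have sum: "(\<Sum>e\<in>?I. F e) = (\<Sum>j<N. \<Sum>l<m. F (j, i, l))" for F :: "nat \<times> nat \<times> nat \<Rightarrow> real"
  proof -
    have "(\<Sum>j<N. \<Sum>l<m. F (j, i, l)) = (\<Sum>j<N. \<Sum>e\<in>{i} \<times> {..<m}. F (j, e))"
      by (simp add: sum.cartesian_product'[of _ "{i}"])
    also have "\<dots> = (\<Sum>e\<in>?I. F e)" by (simp add: sum.cartesian_product')
    finally show ?thesis ..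
  qed
  have sub: "?I \<subseteq> {..<N} \<times> {..<n} \<times> {..<m}" using i by auto
  have "std_subgaussian M (\<lambda>\<omega>. \<Sum>e\<in>?I. (case e of (j, i, l) \<Rightarrow> c j l) * \<xi> e \<omega>)"
    by (rule std_subgaussian_sum[OF _ indep_vars_subset[OF ind sub]])
      (use sub c in \<open>auto simp: sum intro!: \<xi>\<close>)
  then show ?thesis by (simp add: sum)
qed

text \<open>For the lower tail, \<open>\<theta> = - 1 / 24\<close>,
  \<open>\<kappa> = - 1 / 48\<close> and \<open>s = - n / 96\<close> leave the exponent
  \<open>- n / 96\<close>. For the upper tail, \<open>\<theta> = 1 / 4\<close>,
  \<open>\<kappa> = 1\<close> and \<open>s = 4 n\<close> leave \<open>- 3 n\<close>.\<close>

lemma row_tails: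
  fixes c :: "nat \<Rightarrow> nat \<Rightarrow> real" and n N m :: nat
  assumes ind: "indep_vars (\<lambda>_. borel) \<xi> ({..<N} \<times> {..<n} \<times> {..<m})"
    and \<xi>: "\<And>e. e \<in> {..<N} \<times> {..<n} \<times> {..<m} \<Longrightarrow> std_subgaussian M (\<xi> e)"
    and c: "(\<Sum>j<N. \<Sum>l<m. (c j l)\<^sup>2) = 1"
  shows "prob {\<omega> \<in> space M. (\<Sum>i<n. (\<Sum>j<N. \<Sum>l<m. c j l * \<xi> (j, i, l) \<omega>)\<^sup>2) \<le> n / 4} \<le> exp (- n / 96)"
    and "prob {\<omega> \<in> space M. 16 * n \<le> (\<Sum>i<n. (\<Sum>j<N. \<Sum>l<m. c j l * \<xi> (j, i, l) \<omega>)\<^sup>2)} \<le> exp (- 3 * n)"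
proof -
  have X: "std_subgaussian M (\<lambda>\<omega>. \<Sum>j<N. \<Sum>l<m. c j l * \<xi> (j, i, l) \<omega>)" if "i < n" for i
    using std_subgaussian_row[OF ind _ c that] \<xi> by blast
  have 1: "- (n / 96) \<le> - (1 / 24) * S \<longleftrightarrow> S \<le> n / 4" and 2: "4 * n \<le> 1 / 4 * S \<longleftrightarrow> 16 * n \<le> S" for S :: real
    by auto
  show "prob {\<omega> \<in> space M. (\<Sum>i<n. (\<Sum>j<N. \<Sum>l<m. c j l * \<xi> (j, i, l) \<omega>)\<^sup>2) \<le> n / 4} \<le> exp (- n / 96)"
    using chernoff_sum_squares[OF indep_rows[OF ind] std_subgaussian_exp_minus_square[OF X], where s = "- (n / 96)"]
    unfolding 1 by simp
  show "prob {\<omega> \<in> space M. 16 * n \<le> (\<Sum>i<n. (\<Sum>j<N. \<Sum>l<m. c j l * \<xi> (j, i, l) \<omega>)\<^sup>2)} \<le> exp (- 3 * n)"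
    using chernoff_sum_squares[OF indep_rows[OF ind] std_subgaussian_exp_square[OF X], where s = "4 * n"]
    unfolding 2 by simp
qed

section \<open>Gaussian and Bernoulli entries\<close>

lemma std_subgaussian_normal:
  assumes X: "distributed M lborel X std_normal_density"
  shows "std_subgaussian M X"
  unfolding std_subgaussian_def
proof (intro conjI allI)
  show "X \<in> borel_measurable M" using distributed_measurable[OF X] by simp
  show "expectation X = 0" using X by (rule standard_normal_distributed_expectation)
  show "expectation (\<lambda>\<omega>. (X \<omega>)\<^sup>2) = 1"
    using distributed_integral[OF X, of "\<lambda>x. x\<^sup>2"] integral_std_normal_moment_even[of 1] by simp
  fix t :: real
  have "std_normal_density x * exp (t * x) = exp (t\<^sup>2 / 2) * normal_density t 1 x" for x
  proof -
    have "t\<^sup>2 / 2 + - (x - t)\<^sup>2 / 2 = - x\<^sup>2 / 2 + t * x" by (simp add: power2_eq_square field_simps)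
    then show ?thesis by (simp add: normal_density_def exp_add[symmetric])
  qed
  note shift = this
  have "(\<integral>\<^sup>+\<omega>. ennreal (exp (t * X \<omega>)) \<partial>M) =
      (\<integral>\<^sup>+x. ennreal (std_normal_density x) * ennreal (exp (t * x)) \<partial>lborel)"
    by (rule distributed_nn_integral[OF X, symmetric]) simp
  also have "\<dots> = (\<integral>\<^sup>+x. ennreal (exp (t\<^sup>2 / 2)) * ennreal (normal_density t 1 x) \<partial>lborel)"
    by (simp only: ennreal_mult''[OF exp_ge_zero, symmetric] ennreal_mult'[OF exp_ge_zero, symmetric] shift)
  also have "\<dots> = ennreal (exp (t\<^sup>2 / 2))" by (simp add: nn_integral_cmult nn_integral_normal_density)
  finally show "(\<integral>\<^sup>+\<omega>. ennreal (exp (t * X \<omega>)) \<partial>M) \<le> ennreal (exp (t\<^sup>2 / 2))" by simp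
qed

text \<open>The two atoms exhaust the mass, so \<open>X\<close> lies in \<open>[- 1, 1]\<close>
  almost surely, and Hoeffding's lemma for an interval of length 2 gives exactly
  \<open>t^2 / 2\<close>. Negative \<open>t\<close> is handled by applying it to
  \<open>- X\<close>.\<close>

lemma std_subgaussian_rademacher:
  assumes [measurable]: "X \<in> borel_measurable M"
    and p: "prob {\<omega> \<in> space M. X \<omega> = 1} = 1 / 2" "prob {\<omega> \<in> space M. X \<omega> = - 1} = 1 / 2"
  shows "std_subgaussian M X"
proof -
  let ?P = "{\<omega> \<in> space M. X \<omega> = 1}" and ?Q = "{\<omega> \<in> space M. X \<omega> = - 1}"
  have "prob (?P \<union> ?Q) = prob ?P + prob ?Q" by (intro finite_measure_Union) auto
  then have "prob (?P \<union> ?Q) = 1" using p by simp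
  then have "AE \<omega> in M. \<omega> \<in> ?P \<union> ?Q" by (rule AE_prob_1)
  then have AE: "AE \<omega> in M. X \<omega> = 1 \<or> X \<omega> = - 1" by (rule eventually_mono) auto
  have E: "expectation X = 0"
  proof -
    have "expectation X = expectation (\<lambda>\<omega>. indicator ?P \<omega> - indicator ?Q \<omega>)"
    proof (rule integral_cong_AE)
      show "AE \<omega> in M. X \<omega> = indicator ?P \<omega> - indicator ?Q \<omega>"
        using AE AE_space by eventually_elim (auto simp: indicator_def)
    qed measurable
    also have "\<dots> = 0"
      using p by (subst Bochner_Integration.integral_diff) (auto intro!: integrable_real_indicator simp: less_top[symmetric])
    finally show ?thesis .
  qed
  have "expectation (\<lambda>\<omega>. (X \<omega>)\<^sup>2) = expectation (\<lambda>_. 1)"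
    using AE by (intro integral_cong_AE) (auto elim!: eventually_mono)
  then have V: "expectation (\<lambda>\<omega>. (X \<omega>)\<^sup>2) = 1" by (simp add: prob_space)
  interpret A: interval_bounded_random_variable M X "- 1" 1
    by unfold_locales (use AE in \<open>auto elim!: eventually_mono\<close>)
  interpret B: interval_bounded_random_variable M "\<lambda>\<omega>. - X \<omega>" "- 1" 1
    by unfold_locales (use AE in \<open>auto elim!: eventually_mono\<close>)
  have "(\<integral>\<^sup>+\<omega>. ennreal (exp (t * X \<omega>)) \<partial>M) \<le> ennreal (exp (t\<^sup>2 / 2))" for t
  proof -
    consider "t > 0" | "t = 0" | "t < 0" by linarith
    then show ?thesis
    proof cases
      case 1
      then show ?thesis using A.Hoeffdings_lemma_nn_integral_0[OF _ E, of t] by simp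
    next
      case 2
      then show ?thesis by (simp add: emeasure_space_1)
    next
      case 3
      then show ?thesis using B.Hoeffdings_lemma_nn_integral_0[of "- t"] E by simp
    qed
  qed
  then show ?thesis using E V unfolding std_subgaussian_def by simp
qed

end

lemma ensemble_std_subgaussian:
  assumes M: "prob_space M" and ens: "gaussian_ensemble M n m N \<Psi> \<or> bernoulli_ensemble M n m N \<Psi>"
    and e: "e \<in> {..<N} \<times> {..<n} \<times> {..<m}"
  shows "std_subgaussian M (dict_entry \<Psi> e)"
  using ens
proof
  assume "gaussian_ensemble M n m N \<Psi>"
  then show ?thesis using prob_space.std_subgaussian_normal[OF M] e by (auto simp: gaussian_ensemble_def)
next
  assume B: "bernoulli_ensemble M n m N \<Psi>"
  then have "dict_entry \<Psi> e \<in> borel_measurable M"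
    using e by (auto simp: bernoulli_ensemble_def independent_entries_def prob_space.indep_vars_def[OF M])
  then show ?thesis
    using B e by (intro prob_space.std_subgaussian_rademacher[OF M]) (auto simp: bernoulli_ensemble_def)
qed


section \<open>The union bound\<close>

text \<open>Here \<open>a\<close> stands for the normalised \<open>h\<close>. Outside the bad events
  the deterministic rounding argument applies, so failure is covered by one event per column and one
  per lattice point.\<close>

lemma (in prob_space) null_space_property_failure:
  fixes a :: "nat \<Rightarrow> real" and n N m k :: nat
  assumes ind: "indep_vars (\<lambda>_. borel) \<xi> ({..<N} \<times> {..<n} \<times> {..<m})"
    and \<xi>: "\<And>e. e \<in> {..<N} \<times> {..<n} \<times> {..<m} \<Longrightarrow> std_subgaussian M (\<xi> e)"
    and a: "(\<Sum>l<m. (a l)\<^sup>2) = 1"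
    and A: "A = (\<lambda>\<omega> i j. \<Sum>l<m. a l * \<xi> (j, i, l) \<omega>)"
    and k: "k > 0" and n: "n > 0"
  shows "prob {\<omega> \<in> space M. \<not> null_space_property n N k (A \<omega>)} \<le>
    N * exp (- 3 * n) + card (integer_l1_ball N (2048 * k)) * exp (- n / 96)"
proof -
  have \<xi>m: "\<xi> e \<in> borel_measurable M" if "e \<in> {..<N} \<times> {..<n} \<times> {..<m}" for e
    using \<xi>[OF that] by (rule std_subgaussian_measurable)
  have Am: "(\<lambda>\<omega>. A \<omega> i j) \<in> borel_measurable M" if "i < n" "j < N" for i j
    unfolding A using that by (intro borel_measurable_sum borel_measurable_times \<xi>m) auto
  define C where "C j = {\<omega> \<in> space M. 16 * n \<le> (\<Sum>i<n. (A \<omega> i j)\<^sup>2)}" for j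
  define D where "D w = {\<omega> \<in> space M. (\<Sum>i<n. (\<Sum>j<N. A \<omega> i j * of_int (w j))\<^sup>2) < n / 4 * (\<Sum>j<N. (of_int (w j))\<^sup>2)}"
    for w :: "nat \<Rightarrow> int"
  have Cm: "C j \<in> sets M" if "j < N" for j
    unfolding C_def using that
    by (intro borel_measurable_le borel_measurable_sum borel_measurable_power Am) auto
  have Dm: "D w \<in> sets M" for w
    unfolding D_def
    by (intro borel_measurable_less borel_measurable_sum borel_measurable_power borel_measurable_times Am) auto
  have C: "prob (C j) \<le> exp (- 3 * n)" if j: "j < N" for j
  proof -
    \<comment> \<open>A column is the linear form whose coefficients vanish away from
      \<open>j\<close>, so the row tails apply to it.\<close>
    define c where "c j' l = (if j' = j then a l else 0)" for j' l
    have 1: "(\<Sum>j'<N. \<Sum>l<m. c j' l * F j' l) = (\<Sum>l<m. a l * F j l)" for F :: "nat \<Rightarrow> nat \<Rightarrow> real"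
    proof -
      have "(\<Sum>j'<N. \<Sum>l<m. c j' l * F j' l) = (\<Sum>j'<N. if j' = j then \<Sum>l<m. a l * F j' l else 0)"
        by (intro sum.cong) (auto simp: c_def)
      then show ?thesis using j by simp
    qed
    have "(\<Sum>j'<N. \<Sum>l<m. (c j' l)\<^sup>2) = 1"
      using 1[of c] a by (simp add: power2_eq_square c_def)
    from row_tails(2)[OF ind \<xi> this] show ?thesis unfolding C_def A 1 by simp
  qed
  have D: "prob (D w) \<le> exp (- n / 96)" for w
  proof (cases "(\<Sum>j<N. (real_of_int (w j))\<^sup>2) = 0")
    case True
    \<comment> \<open>For a zero vector the strict inequality cannot hold.\<close>
    have "D w = {}" unfolding D_def True by (auto simp: not_less intro: sum_nonneg)
    then show ?thesis by simp
  next
    case False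
    define s where "s = sqrt (\<Sum>j<N. (real_of_int (w j))\<^sup>2)"
    have s2: "s\<^sup>2 = (\<Sum>j<N. (real_of_int (w j))\<^sup>2)" unfolding s_def by (simp add: sum_nonneg)
    have s: "s \<noteq> 0" using False unfolding s2[symmetric] by auto
    \<comment> \<open>The coefficients are a product of the unit vectors \<open>w / s\<close> and
      \<open>a\<close>, hence again of unit length.\<close>
    define c where "c j l = of_int (w j) / s * a l" for j l
    have "(\<Sum>j<N. \<Sum>l<m. (c j l)\<^sup>2) = (\<Sum>j<N. (of_int (w j) / s)\<^sup>2)"
      unfolding c_def power_mult_distrib sum_distrib_left[symmetric] a by simp
    also have "\<dots> = 1" using s by (simp add: power_divide sum_divide_distrib[symmetric] s2[symmetric])
    finally have c: "(\<Sum>j<N. \<Sum>l<m. (c j l)\<^sup>2) = 1" .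
    have eq: "(\<Sum>j<N. \<Sum>l<m. c j l * \<xi> (j, i, l) \<omega>) = (\<Sum>j<N. A \<omega> i j * of_int (w j)) / s" for i \<omega>
      unfolding A c_def sum_divide_distrib sum_distrib_right by (intro sum.cong refl) simp
    have row: "{\<omega> \<in> space M. (\<Sum>i<n. (\<Sum>j<N. \<Sum>l<m. c j l * \<xi> (j, i, l) \<omega>)\<^sup>2) \<le> n / 4} =
        {\<omega> \<in> space M. (\<Sum>i<n. (\<Sum>j<N. A \<omega> i j * of_int (w j))\<^sup>2) \<le> n / 4 * s\<^sup>2}"
      unfolding eq power_divide sum_divide_distrib[symmetric] using s by (simp add: pos_divide_le_eq)
    have "prob (D w) \<le> prob {\<omega> \<in> space M. (\<Sum>i<n. (\<Sum>j<N. A \<omega> i j * of_int (w j))\<^sup>2) \<le> n / 4 * s\<^sup>2}"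
    proof (rule finite_measure_mono)
      show "D w \<subseteq> {\<omega> \<in> space M. (\<Sum>i<n. (\<Sum>j<N. A \<omega> i j * of_int (w j))\<^sup>2) \<le> n / 4 * s\<^sup>2}"
        unfolding D_def s2 by auto
      show "{\<omega> \<in> space M. (\<Sum>i<n. (\<Sum>j<N. A \<omega> i j * of_int (w j))\<^sup>2) \<le> n / 4 * s\<^sup>2} \<in> sets M"
        by (intro borel_measurable_le borel_measurable_sum borel_measurable_power borel_measurable_times Am) auto
    qed
    also have "\<dots> \<le> exp (- n / 96)" using row_tails(1)[OF ind \<xi> c] unfolding row by simp
    finally show ?thesis .
  qed
  let ?W = "integer_l1_ball N (2048 * k)"
  have sub: "{\<omega> \<in> space M. \<not> null_space_property n N k (A \<omega>)} \<subseteq> (\<Union>j<N. C j) \<union> (\<Union>w\<in>?W. D w)"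
  proof (rule subsetI, rule ccontr)
    fix \<omega> assume "\<omega> \<in> {\<omega> \<in> space M. \<not> null_space_property n N k (A \<omega>)}"
      and not: "\<omega> \<notin> (\<Union>j<N. C j) \<union> (\<Union>w\<in>?W. D w)"
    then have \<omega>: "\<omega> \<in> space M" "\<not> null_space_property n N k (A \<omega>)" by auto
    have col: "(\<Sum>i<n. (A \<omega> i j)\<^sup>2) \<le> 16 * real n" if "j < N" for j
      using not that \<omega>(1) by (auto simp: C_def not_le intro: less_imp_le)
    obtain z where z: "\<And>i. i < n \<Longrightarrow> (\<Sum>j<N. A \<omega> i j * z j) = 0" "\<exists>j<N. z j \<noteq> 0"
      "(\<Sum>j<N. \<bar>z j\<bar>) \<le> 2 * sqrt k * sqrt (\<Sum>j<N. (z j)\<^sup>2)"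
      using flat_kernel_vector[OF \<omega>(2)] by blast
    obtain w where "w \<in> ?W" "(\<Sum>i<n. (\<Sum>j<N. A \<omega> i j * of_int (w j))\<^sup>2) < n / 4 * (\<Sum>j<N. (of_int (w j))\<^sup>2)"
      using lattice_point_of_kernel_vector[OF col z k n] by blast
    with not \<omega>(1) show False by (auto simp: D_def)
  qed
  have UC: "(\<Union>j<N. C j) \<in> sets M" and UD: "(\<Union>w\<in>?W. D w) \<in> sets M"
    using Cm Dm by (auto intro!: sets.finite_UN finite_integer_l1_ball)
  have "prob {\<omega> \<in> space M. \<not> null_space_property n N k (A \<omega>)} \<le> prob ((\<Union>j<N. C j) \<union> (\<Union>w\<in>?W. D w))"
    by (rule finite_measure_mono[OF sub]) (use UC UD in auto)
  also have "\<dots> \<le> prob (\<Union>j<N. C j) + prob (\<Union>w\<in>?W. D w)"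
    by (rule measure_Un_le[OF UC UD])
  also have "prob (\<Union>j<N. C j) \<le> (\<Sum>j<N. prob (C j))"
    by (rule finite_measure_subadditive_finite) (use Cm in auto)
  also have "\<dots> \<le> (\<Sum>j<N. exp (- 3 * n))" using C by (intro sum_mono) auto
  also have "prob (\<Union>w\<in>?W. D w) \<le> (\<Sum>w\<in>?W. prob (D w))"
    by (rule finite_measure_subadditive_finite) (use Dm finite_integer_l1_ball in auto)
  also have "\<dots> \<le> (\<Sum>w\<in>?W. exp (- n / 96))" using D by (intro sum_mono) auto
  finally show ?thesis by simp
qed

text \<open>For \<open>k \<le> c n\<close> and \<open>k ln (N / (n \<epsilon>)) \<le> c n\<close> the logarithm of the number of lattice points is
  at most \<open>2048 (3 c + 2 sqrt c) n\<close>; \<open>c\<close> is chosen to make this at most half of the exponent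
  \<open>n / 96\<close> of the probability that a single lattice point is bad.\<close>

definition recovery_constant :: real where "recovery_constant = 1 / (4 * 10 ^ 12)"

lemma card_net_bound:
  fixes n N k :: nat and \<epsilon> :: real
  assumes n: "n > 0" "n < N" and k: "k > 0" and \<epsilon>: "0 < \<epsilon>" "\<epsilon> < 1"
    and kL: "real k * ln (real N / (real n * \<epsilon>)) \<le> recovery_constant * real n"
    and kn: "real k \<le> recovery_constant * real n"
  shows "card (integer_l1_ball N (2048 * k)) \<le> exp (n / 192)"
proof -
  let ?r = "real (2048 * k)"
  have kN: "real k \<le> real N" using kn n by (simp add: recovery_constant_def)
  have lnNn: "k * ln (N / n) \<le> recovery_constant * n"
  proof -
    have "N / n \<le> N / (n * \<epsilon>)" using n \<epsilon> by (intro divide_left_mono) auto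
    then have "ln (N / n) \<le> ln (N / (n * \<epsilon>))" using n by (intro ln_mono) auto
    then have "k * ln (N / n) \<le> k * ln (N / (n * \<epsilon>))" by (intro mult_left_mono) auto
    with kL show ?thesis by simp
  qed
  \<comment> \<open>The bound \<open>ln t <= 2 * sqrt t\<close> turns this term into
    \<open>2 * sqrt (k * n)\<close>, and \<open>recovery_constant\<close> has square root
    \<open>1 / (2 * 10^6)\<close>.\<close>
  have lnnk: "k * ln (n / k) \<le> n / 10 ^ 6"
  proof -
    have "ln (n / k) = 2 * ln (sqrt (n / k))" using n k by (simp add: ln_sqrt)
    also have "ln (sqrt (n / k)) \<le> sqrt (n / k)" using n k ln_le_minus_one[of "sqrt (n / k)"] by simp
    finally have "k * ln (n / k) \<le> 2 * (k * sqrt (n / k))" using k by simp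
    also have "k * sqrt (n / k) = sqrt (k * n)"
      using k by (simp add: real_sqrt_mult real_sqrt_divide field_simps)
    also have "\<dots> \<le> sqrt ((n / (2 * 10 ^ 6))\<^sup>2)"
    proof (rule real_sqrt_le_mono)
      have "real k * n \<le> recovery_constant * n * n" using kn by (intro mult_right_mono) auto
      then show "real (k * n) \<le> (n / (2 * 10 ^ 6))\<^sup>2"
        by (simp add: recovery_constant_def power2_eq_square)
    qed
    finally show ?thesis by simp
  qed
  have "card (integer_l1_ball N (2048 * k)) \<le> exp ?r * ((2 * real N + ?r) / ?r) ^ (2048 * k)"
    using card_integer_l1_ball[of "2048 * k" N] k by simp
  \<comment> \<open>The base is \<open>2 N / r + 1\<close>; giving up the factor 2048 in
    \<open>r\<close> leaves room to absorb the 1, because \<open>k <= N\<close>.\<close>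
  also have "\<dots> \<le> exp ?r * (2 * (N / k)) ^ (2048 * k)"
    using k kN by (intro mult_left_mono power_mono) (auto simp: field_simps)
  also have "(2 * (N / k)) ^ (2048 * k) = exp (?r * ln (2 * (N / k)))"
    using n k by (subst exp_of_nat_mult) simp
  also have "ln (2 * (real N / k)) = ln 2 + ln (N / n) + ln (n / k)"
  proof -
    have "2 * (real N / k) = 2 * (N / n) * (n / k)" using n by simp
    also have "ln \<dots> = ln 2 + ln (N / n) + ln (n / k)"
      using n k by (subst ln_mult_pos; (subst ln_mult_pos)?; simp)
    finally show ?thesis .
  qed
  also have "exp ?r * exp (?r * (ln 2 + ln (N / n) + ln (n / k))) =
      exp (2048 * (k + k * ln 2 + k * ln (N / n) + k * ln (n / k)))"
    by (simp add: exp_add[symmetric] algebra_simps)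
  also have "\<dots> \<le> exp (n / 192)"
  proof -
    have "k * ln 2 \<le> k * (1::real)" using ln_le_minus_one[of 2] by (intro mult_left_mono) auto
    then have "k + k * ln 2 + k * ln (N / n) + k * ln (n / k) \<le> 3 * (recovery_constant * n) + n / 10 ^ 6"
      using lnNn lnnk kn by linarith
    also have "\<dots> \<le> n / 192 / 2048" by (simp add: recovery_constant_def)
    finally show ?thesis by simp
  qed
  finally show ?thesis .
qed

text \<open>Write \<open>c\<close> for \<open>recovery_constant\<close>. As \<open>k >= 1\<close>,
  the logarithm is at most \<open>c n\<close>, so \<open>N <= n \<epsilon> exp (c n)\<close>, and
  \<open>n < N\<close> then gives \<open>1 <= \<epsilon> exp (c n)\<close>. These two inequalities
  bring the factor \<epsilon> into both exponential bounds, each of which becomes at most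
  \<open>\<epsilon> / 2\<close>.\<close>

lemma failure_bound:
  fixes n N k :: nat and \<epsilon> :: real
  assumes n: "n > 0" "n < N" and k: "k > 0" and \<epsilon>: "0 < \<epsilon>" "\<epsilon> < 1"
    and kL: "real k * ln (real N / (real n * \<epsilon>)) \<le> recovery_constant * real n"
    and kn: "real k \<le> recovery_constant * real n"
  shows "N * exp (- 3 * real n) + card (integer_l1_ball N (2048 * k)) * exp (- n / 96) \<le> \<epsilon>"
proof -
  let ?L = "ln (real N / (real n * \<epsilon>))"
  have "real n * \<epsilon> < real n * 1" using n \<epsilon> by (intro mult_strict_left_mono) auto
  also have "\<dots> < N" using n by simp
  finally have "n * \<epsilon> < N" .
  then have gt1: "N / (n * \<epsilon>) > 1" using n \<epsilon> by (simp add: less_divide_eq)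
  then have "?L > 0" by simp
  then have "1 * ?L \<le> k * ?L" using k by (intro mult_right_mono) auto
  then have "?L \<le> recovery_constant * n" using kL by simp
  then have "exp ?L \<le> exp (recovery_constant * n)" by simp
  then have "N / (n * \<epsilon>) \<le> exp (recovery_constant * n)" using gt1 by simp
  then have N: "N \<le> n * \<epsilon> * exp (recovery_constant * n)"
    using n \<epsilon> by (simp add: divide_le_eq mult_ac)
  have "N * exp (- 3 * real n) \<le> n * \<epsilon> * exp (recovery_constant * n) * exp (- 3 * real n)"
    using N by (intro mult_right_mono) auto
  also have "\<dots> = \<epsilon> * (n * exp (recovery_constant * n + - 3 * real n))"
    by (simp only: exp_add mult_ac)
  also have "\<dots> \<le> \<epsilon> * (n * exp (- (2 * real n)))"
    using \<epsilon> by (intro mult_left_mono) (auto simp: recovery_constant_def)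
  also have "n * exp (- (2 * real n)) \<le> 1 / 2"
  proof -
    have "2 * real n \<le> exp (2 * real n)" using exp_ge_add_one_self[of "2 * real n"] by linarith
    then show ?thesis by (simp add: exp_minus divide_inverse[symmetric] divide_le_eq mult.commute)
  qed
  finally have 1: "N * exp (- 3 * real n) \<le> \<epsilon> / 2" using \<epsilon> by simp
  have n1: "1 \<le> \<epsilon> * exp (recovery_constant * n)"
  proof -
    have "real n * 1 \<le> N" using n by simp
    also have "\<dots> \<le> n * (\<epsilon> * exp (recovery_constant * n))" using N by (simp add: mult_ac)
    finally show ?thesis using n by (simp only: mult_le_cancel_left_pos of_nat_0_less_iff)
  qed
  have "card (integer_l1_ball N (2048 * k)) * exp (- n / 96) \<le> exp (n / 192) * exp (- n / 96)"
    using card_net_bound[OF assms] by (intro mult_right_mono) auto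
  also have "\<dots> \<le> \<epsilon> * exp (recovery_constant * n) * (exp (n / 192) * exp (- n / 96))"
    using mult_right_mono[OF n1, of "exp (n / 192) * exp (- n / 96)"] by simp
  also have "\<dots> = \<epsilon> * exp (recovery_constant * n + n / 192 + - n / 96)"
    by (simp only: exp_add mult_ac)
  also have "\<dots> \<le> \<epsilon> * exp (- 1)"
  proof -
    \<comment> \<open>Since \<open>k >= 1\<close>, the bound on \<open>k\<close> forces
      \<open>n >= 4 * 10^12\<close>, so an exponent of about \<open>- n / 192\<close> is far below
      \<open>- 1\<close>.\<close>
    have "recovery_constant * n \<ge> 1" using kn k by linarith
    then have "recovery_constant * n + n / 192 + - n / 96 \<le> - 1" by (simp add: recovery_constant_def)
    then show ?thesis using \<epsilon> by simp
  qed
  also have "\<dots> \<le> \<epsilon> * (1 / 2)"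
    using exp_ge_add_one_self[of 1] \<epsilon> by (intro mult_left_mono) (auto simp: exp_minus divide_simps)
  finally show ?thesis using 1 by simp
qed

theorem theorem2p3:
  shows "\<exists>c::real. c > 0 \<and>
    (\<forall>(m::nat) (n::nat) (N::nat) (h::real Matrix.vec) (M::'w measure)
        (\<Psi>::nat \<Rightarrow> 'w \<Rightarrow> real Matrix.mat) (\<epsilon>::real) (k::nat).
       m > 0 \<longrightarrow> n > 0 \<longrightarrow> n < N \<longrightarrow>
       h \<in> carrier_vec m \<longrightarrow> h \<noteq> 0\<^sub>v m \<longrightarrow>
       prob_space M \<longrightarrow>
       gaussian_ensemble M n m N \<Psi> \<or> bernoulli_ensemble M n m N \<Psi> \<longrightarrow>
       \<epsilon> > 0 \<longrightarrow> k > 0 \<longrightarrow>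
       real k \<le> c * (real n / ln (real N / (real n * \<epsilon>))) \<longrightarrow>
       real k \<le> c * real n \<longrightarrow>
       measure M {\<omega> \<in> space M. bp_recovers_all_sparse n m N (\<lambda>j. \<Psi> j \<omega>) h k} \<ge> 1 - \<epsilon>)"
proof (intro exI[of _ recovery_constant] conjI allI impI)
  show "recovery_constant > 0" by (simp add: recovery_constant_def)
next
  fix m n N k :: nat and h :: "real Matrix.vec" and M :: "'w measure"
    and \<Psi> :: "nat \<Rightarrow> 'w \<Rightarrow> real Matrix.mat" and \<epsilon> :: real
  assume n: "n > 0" "n < N" and h: "h \<in> carrier_vec m" "h \<noteq> 0\<^sub>v m" and M: "prob_space M"
    and ens: "gaussian_ensemble M n m N \<Psi> \<or> bernoulli_ensemble M n m N \<Psi>"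
    and \<epsilon>: "\<epsilon> > 0" and k: "k > 0"
    and kL: "real k \<le> recovery_constant * (real n / ln (real N / (real n * \<epsilon>)))"
    and kn: "real k \<le> recovery_constant * real n"
  interpret prob_space M by (rule M)
  let ?E = "{\<omega> \<in> space M. bp_recovers_all_sparse n m N (\<lambda>j. \<Psi> j \<omega>) h k}"
  show "1 - \<epsilon> \<le> prob ?E"
  \<comment> \<open>For \<open>\<epsilon> >= 1\<close> the claim is trivial. Otherwise
    \<open>N / (n \<epsilon>) > 1\<close>, so the logarithm is positive and the bound on
    \<open>k\<close> can be multiplied out.\<close>
  proof (cases "\<epsilon> < 1")
    case True
    have "real n * \<epsilon> < real n * 1" using n True by (intro mult_strict_left_mono) auto
    also have "\<dots> < N" using n by simp
    finally have "n * \<epsilon> < N" .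
    then have "N / (n * \<epsilon>) > 1" using n \<epsilon> by (simp add: less_divide_eq)
    then have "real k * ln (real N / (real n * \<epsilon>)) \<le> recovery_constant * n"
      using kL by (simp add: le_divide_eq)
    note bound = failure_bound[OF n k \<epsilon> True this kn]
    have carr: "\<forall>j<N. \<Psi> j \<omega> \<in> carrier_mat n m" if "\<omega> \<in> space M" for \<omega>
      using ens that by (auto simp: gaussian_ensemble_def bernoulli_ensemble_def independent_entries_def)
    have ind: "indep_vars (\<lambda>_. borel) (dict_entry \<Psi>) ({..<N} \<times> {..<n} \<times> {..<m})"
      using ens by (auto simp: gaussian_ensemble_def bernoulli_ensemble_def independent_entries_def)
    note entry = ensemble_std_subgaussian[OF M ens]
    \<comment> \<open>Dividing by the length of \<open>h\<close> gives unit coefficients and leaves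
      the kernel of the measurement matrix unchanged.\<close>
    define b where "b = sqrt (\<Sum>l<m. (vec_index h l)\<^sup>2)"
    have b2: "b\<^sup>2 = (\<Sum>l<m. (vec_index h l)\<^sup>2)" unfolding b_def by (simp add: sum_nonneg)
    have b: "b \<noteq> 0"
    proof
      assume "b = 0"
      then have "\<forall>l<m. vec_index h l = 0" using b2 by (simp add: sum_nonneg_eq_0_iff)
      then have "h = 0\<^sub>v m" using h(1) by (intro eq_vecI) auto
      with h(2) show False by simp
    qed
    define a where "a l = vec_index h l / b" for l
    have a: "(\<Sum>l<m. (a l)\<^sup>2) = 1"
      using b by (simp add: a_def power_divide sum_divide_distrib[symmetric] b2[symmetric])
    define A where "A = (\<lambda>\<omega> i j. \<Sum>l<m. a l * dict_entry \<Psi> (j, i, l) \<omega>)"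
    have A_eq: "A \<omega> = (\<lambda>i j. 1 / b * measurement m (\<lambda>j. \<Psi> j \<omega>) h i j)" for \<omega>
      by (simp add: A_def a_def measurement_def dict_entry_def sum_distrib_left mult_ac)
    have "null_space_property n N k (A \<omega>) \<longleftrightarrow> null_space_property n N k (measurement m (\<lambda>j. \<Psi> j \<omega>) h)" for \<omega>
      unfolding A_eq by (rule null_space_property_scale) (use b in simp)
    then have E: "?E = {\<omega> \<in> space M. null_space_property n N k (A \<omega>)}"
      using recovers_iff_null_space_property[OF carr h(1)] by auto
    have "(\<lambda>\<omega>. A \<omega> i j) \<in> borel_measurable M" if "i < n" "j < N" for i j
      unfolding A_def using that
      by (intro borel_measurable_sum borel_measurable_times std_subgaussian_measurable[OF entry]) auto
    then have "{\<omega> \<in> space M. null_space_property n N k (A \<omega>)} \<in> events"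
      by (rule measurable_null_space_property)
    from prob_neg[OF this] have "prob {\<omega> \<in> space M. null_space_property n N k (A \<omega>)} =
        1 - prob {\<omega> \<in> space M. \<not> null_space_property n N k (A \<omega>)}"
      by simp
    moreover have "prob {\<omega> \<in> space M. \<not> null_space_property n N k (A \<omega>)} \<le> \<epsilon>"
      using null_space_property_failure[OF ind entry a A_def k n(1)] bound by simp
    ultimately show ?thesis unfolding E by simp
  qed (use measure_nonneg[of M ?E] in linarith)
qed

end
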